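(* Let $s\in\mathbb N_+$, and let $(\varphi_k)_{k\in\mathbb N_+}$ be a fixed enumeration of the vector-valued chaoslet orthonormal basis of $\mathcal H^2_T(\mathbb R^d)$, with $\deg(\varphi_k)\in\mathbb N$ the Wiener-chaos degree of $\varphi_k$. Let $(\xi_k)_{k\in\mathbb N_+}$ be centered, unit-variance, i.i.d. real-valued sub-Gaussian random variables. Suppose that there exist $0<p_{\mathrm{cmp}}<2$, $\vartheta=(\vartheta_k)_{k\in\mathbb N_+}\in\ell^{p_{\mathrm{cmp}}}$, and a unitary operator $U:\mathcal H^2_T(\mathbb R^d)\to\mathcal H^2_T(\mathbb R^d)$ such that the matrix $A_U=(\langle U\varphi_n,\varphi_m\rangle)_{m,n\in\mathbb N_+}$ defines a bounded linear operator $A_U:\ell^{p_{\mathrm{cmp}}}\to\ell^{p_{\mathrm{cmp}}}$. Suppose in addition that $\vartheta\in\ell^2_{\varphi,s}$, where $$\ell^2_{\varphi,s}=\Big\{a=(a_k)_{k\in\mathbb N_+}:\ \sum_{k=1}^\infty(1+\deg(\varphi_k))^s|a_k|^2<\infty\Big\},$$ and that $A_U:\ell^2_{\varphi,s}\to\ell^2_{\varphi,s}$ is bounded. Let $\mu_{\vartheta,U}$ be the law of the random predictable process $$\sum_{k=1}^\infty\vartheta_k\,\xi_k\,U\varphi_k ,$$ a Borel probability measure on $\mathbb D^{s,2:d}_T$. If $\operatorname{Law}(X)=\mu_{\vartheta,U}$, then $X$ is $S$-compressible with $S=\frac1{p_{\mathrm{cmp}}}$ and belongs to $\mathbb D^{s,2:d}_T$,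 $\mu_{\vartheta,U}$-almost surely. In particular, its best $N$-term chaoslet approximation error is $\mathcal O\big(N^{-(\frac1{p_{\mathrm{cmp}}}-\frac12)}\big)$.
   Context: $\mathbb N=\{0,1,2,\dots\}$, $\mathbb N_+=\{1,2,\dots\}$, $[n]_+=\{1,\dots,n\}$. Fix $T>0$, $D,d\in\mathbb N_+$, and a $D$-dimensional Brownian motion $W$ on a complete probability space, with $(\mathcal F_t)_{0\le t\le T}$ the usual augmentation of its filtration. $\mathcal H^2_T(\mathbb R^d)$ is the Hilbert space of $\mathbb R^d$-valued predictable processes $u$ with $\|u\|^2_{\mathcal H^2_T(\mathbb R^d)}=\mathbb E\int_0^T|u_t|^2\,dt<\infty$, with inner product $\langle\cdot,\cdot\rangle$; $\mathcal H^2_T:=\mathcal H^2_T(\mathbb R)$. The series $\sum_k\vartheta_k\xi_kU\varphi_k$ is regarded as a random element of $\mathcal H^2_T(\mathbb R^d)$. $\ell^p$ ($0<p<\infty$) is the space of real sequences with $\sum|a_k|^p<\infty$, with its usual (quasi-)norm. Chaoslets. $h_n=\mathrm{He}_n/\sqrt{n!}$ with $\mathrm{He}_n(x)=(-1)^ne^{x^2/2}\frac{d^n}{dx^n}e^{-x^2/2}$. For $i\in\mathbb N$, $0\le k<2^i$, $$\psi_{i,k}(t)=\tfrac{2^{i/2}}{\sqrt T}\Big(-\mathbf 1_{[\frac{Tk}{2^i},\frac{T(1+2k)}{2^{i+1}})}(t)+\mathbf 1_{[\frac{T(1+2k)}{2^{i+1}},\frac{T(k+1)}{2^i})}(t)\Big),$$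 and for $r\in[D]_+$, $Z^r_{i,k}=\frac{2^{i/2}}{\sqrt T}\big(W^r_{Tk/2^i}-2W^r_{T(1+2k)/2^{i+1}}+W^r_{T(k+1)/2^i}\big)$. For $p\in\mathbb N$, $0\le q\le2^p-1$ let $\mathcal I_{p,q}=\{(i,k)\in\mathbb N^2:0\le k<2^i,\ \frac{k+1}{2^i}\le\frac q{2^p}\}$. For a finitely supported family $\boldsymbol\alpha=(\alpha^r_{i,k})_{(i,k)\in\mathcal I_{p,q},\,r\in[D]_+}$ in $\mathbb N$, the chaoslet is $$\mathfrak C^{\boldsymbol\alpha}_{(p,q)}(t,\omega)=\psi_{p,q}(t)\prod_{(i,k)\in\mathcal I_{p,q}}\prod_{r=1}^D h_{\alpha^r_{i,k}}(Z^r_{i,k}(\omega)),$$ of Wiener-chaos degree $|\boldsymbol\alpha|=\sum\alpha^r_{i,k}$. The constant process $1/\sqrt T$ is also included, with degree $0$. The family of all these processes is taken to be an orthonormal basis $\mathfrak C=\bigcup_{n\ge0}\mathfrak C_n$ of $\mathcal H^2_T$ (a fact quoted from the literature), where $\mathfrak C_n$ is the set of chaoslets of degree $n$. The vector-valued chaoslet orthonormal basis of $\mathcal H^2_T(\mathbb R^d)$ consists of the processes $\mathfrak m\,e_j$, $\mathfrak m\in\mathfrak C$, $j\in[d]_+$, with $(e_j)$ the canonical basis of $\mathbb R^d$, and $\deg(\mathfrak m e_j)$ is the degree of $\mathfrak m$. Malliavin–Sobolev space. $\mathbb D^{s,2}_T=\{X\in\mathcal H^2_T:\sum_{n\ge0}(1+n)^s\|\bar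 J_nX\|^2_{\mathcal H^2_T}<\infty\}$, where $\bar J_n$ is the orthogonal projection in $\mathcal H^2_T$ onto the closed linear span of $\mathfrak C_n$; $\mathbb D^{s,2:d}_T$ is defined component-wise for $\mathbb R^d$-valued processes. Compressibility. $X\in\mathcal H^2_T(\mathbb R^d)$ with chaoslet expansion $X=\sum_{k\ge0}\sum_{\mathfrak m\in\mathfrak C_k}\beta_{k,\mathfrak m}\mathfrak m$, $\beta_{k,\mathfrak m}\in\mathbb R^d$, is $S$-compressible if there is $C_X>0$ such that the non-increasing rearrangement $(\beta^\star_r)_{r\ge1}$ of the norms $(|\beta_{k,\mathfrak m}|_{\mathbb R^d})_{k,\mathfrak m}$ satisfies $\beta^\star_r\le C_X r^{-S}$ for all $r\in\mathbb N_+$. The best $N$-term chaoslet approximation error of $X$ is the infimum of $\|X-\sum_{n=1}^N\beta_n\mathfrak m^{(n)}\|_{\mathcal H^2_T(\mathbb R^d)}$ over $\beta_n\in\mathbb R^d$ and chaoslets $\mathfrak m^{(n)}\in\mathfrak C$.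
   Formalization: With the index sets as given, the chaoslets are not complete in H²_T (1_{[T/2,T)}(t)W_{T/4} is orthogonal to all); so H²_T, and with it U, the law and the Malliavin–Sobolev space, is replaced by a closed subspace in which the chaoslets form an orthonormal basis (H²_T itself, if complete). *)

theory Defs
  imports "HOL-Probability.Probability" "HOL-Library.Landau_Symbols"
begin

section \<open>Brownian motion, its augmented filtration and predictability\<close>

definition brownian_motion ::
    "real \<Rightarrow> 'a measure \<Rightarrow> (real \<Rightarrow> 'a \<Rightarrow> real ^ 'n) \<Rightarrow> bool" where
  "brownian_motion T M W \<longleftrightarrow>
     (\<forall>t\<in>{0..T}. W t \<in> borel_measurable M) \<and>
     (AE \<omega> in M. W 0 \<omega> = 0) \<and>
     (AE \<omega> in M. continuous_on {0..T} (\<lambda>t. W t \<omega>)) \<and>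
     (\<forall>s t r. 0 \<le> s \<and> s < t \<and> t \<le> T \<longrightarrow>
        distributed M lborel (\<lambda>\<omega>. W t \<omega> $ r - W s \<omega> $ r) (normal_density 0 (sqrt (t - s)))) \<and>
     (\<forall>m ts. 0 \<le> ts 0 \<and> (\<forall>i<m. ts i \<le> ts (Suc i)) \<and> ts m \<le> T \<longrightarrow>
        prob_space.indep_vars M (\<lambda>_. borel)
          (\<lambda>(i, r) \<omega>. W (ts (Suc i)) \<omega> $ r - W (ts i) \<omega> $ r) ({..<m::nat} \<times> UNIV))"

definition null_augmented ::
    "'a measure \<Rightarrow> (real \<Rightarrow> 'a \<Rightarrow> real ^ 'n) \<Rightarrow> real \<Rightarrow> 'a set set" where
  "null_augmented M W t =
     sigma_sets (space M)
       ({W u -` B \<inter> space M | u B. u \<in> {0..t} \<and> B \<in> sets borel} \<union> null_sets M)"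

text \<open>Right limit within \<open>[0,T]\<close>; the index \<open>T\<close> is inserted so that the
  intersection is not empty at the terminal time.\<close>

definition usual_filtration ::
    "real \<Rightarrow> 'a measure \<Rightarrow> (real \<Rightarrow> 'a \<Rightarrow> real ^ 'n) \<Rightarrow> real \<Rightarrow> 'a set set" where
  "usual_filtration T M W t = (\<Inter>s\<in>insert T {t<..<T}. null_augmented M W s)"

definition predictable ::
    "real \<Rightarrow> 'a measure \<Rightarrow> (real \<Rightarrow> 'a \<Rightarrow> real ^ 'n) \<Rightarrow> (real \<times> 'a) measure" where
  "predictable T M W =
     sigma ({0..T} \<times> space M)
       ({{0} \<times> A | A. A \<in> usual_filtration T M W 0} \<union>
        {{s<..t} \<times> A | s t A. 0 \<le> s \<and> s < t \<and> t \<le> T \<and> A \<in> usual_filtration T M W s})"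

section \<open>Square-integrable predictable processes\<close>

text \<open>Processes are functions on \<open>[0,T] \<times> \<Omega>\<close>; no quotient by \<open>dt \<otimes> P\<close>-almost everywhere
  equality is formed, so \<open>h2_norm\<close> is a seminorm, and the notions below respect that equality.\<close>

definition dt_P :: "real \<Rightarrow> 'a measure \<Rightarrow> (real \<times> 'a) measure" where
  "dt_P T M = restrict_space lborel {0..T} \<Otimes>\<^sub>M M"

definition h2 ::
    "real \<Rightarrow> 'a measure \<Rightarrow> (real \<Rightarrow> 'a \<Rightarrow> real ^ 'n) \<Rightarrow> (real \<times> 'a \<Rightarrow> 'b::euclidean_space) set" where
  "h2 T M W = {u. u \<in> borel_measurable (predictable T M W) \<and>
                  integrable (dt_P T M) (\<lambda>x. (norm (u x))\<^sup>2)}"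

definition h2_inner ::
    "real \<Rightarrow> 'a measure \<Rightarrow> (real \<times> 'a \<Rightarrow> 'b::euclidean_space) \<Rightarrow> (real \<times> 'a \<Rightarrow> 'b) \<Rightarrow> real" where
  "h2_inner T M u v = (\<integral>x. u x \<bullet> v x \<partial>dt_P T M)"

definition h2_norm ::
    "real \<Rightarrow> 'a measure \<Rightarrow> (real \<times> 'a \<Rightarrow> 'b::euclidean_space) \<Rightarrow> real" where
  "h2_norm T M u = sqrt (h2_inner T M u u)"

definition h2_closed_span ::
    "real \<Rightarrow> 'a measure \<Rightarrow> (real \<Rightarrow> 'a \<Rightarrow> real ^ 'n) \<Rightarrow> ('i \<Rightarrow> real \<times> 'a \<Rightarrow> real) \<Rightarrow> 'i set
      \<Rightarrow> (real \<times> 'a \<Rightarrow> real) set" where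
  "h2_closed_span T M W f I =
     {u \<in> h2 T M W. \<forall>e>0. \<exists>F c. finite F \<and> F \<subseteq> I \<and>
        h2_norm T M (\<lambda>x. u x - (\<Sum>l\<in>F. c l * f l x)) < e}"

definition h2_closed_subspace ::
    "real \<Rightarrow> 'a measure \<Rightarrow> (real \<Rightarrow> 'a \<Rightarrow> real ^ 'n) \<Rightarrow> (real \<times> 'a \<Rightarrow> real) set \<Rightarrow> bool" where
  "h2_closed_subspace T M W V \<longleftrightarrow>
     V \<subseteq> h2 T M W \<and> (\<lambda>_. 0) \<in> V \<and>
     (\<forall>u\<in>V. \<forall>v\<in>V. \<forall>a b. (\<lambda>x. a * u x + b * v x) \<in> V) \<and>
     (\<forall>u\<in>h2 T M W. (\<forall>e>0. \<exists>v\<in>V. h2_norm T M (\<lambda>x. u x - v x) < e) \<longrightarrow> u \<in> V)"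

definition h2_onb ::
    "real \<Rightarrow> 'a measure \<Rightarrow> (real \<Rightarrow> 'a \<Rightarrow> real ^ 'n) \<Rightarrow> (real \<times> 'a \<Rightarrow> real) set
      \<Rightarrow> ('i \<Rightarrow> real \<times> 'a \<Rightarrow> real) \<Rightarrow> 'i set \<Rightarrow> bool" where
  "h2_onb T M W V f I \<longleftrightarrow>
     (\<forall>l\<in>I. f l \<in> V) \<and>
     (\<forall>l\<in>I. \<forall>l'\<in>I. h2_inner T M (f l) (f l') = (if l = l' then 1 else 0)) \<and>
     V \<subseteq> h2_closed_span T M W f I"

definition h2_proj ::
    "real \<Rightarrow> 'a measure \<Rightarrow> (real \<times> 'a \<Rightarrow> real) set \<Rightarrow> (real \<times> 'a \<Rightarrow> real) \<Rightarrow> (real \<times> 'a \<Rightarrow> real)" where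
  "h2_proj T M K X = (SOME Y. Y \<in> K \<and> (\<forall>Z\<in>K. h2_inner T M (\<lambda>x. X x - Y x) Z = 0))"

definition vec_space ::
    "(real \<times> 'a \<Rightarrow> real) set \<Rightarrow> (real \<times> 'a \<Rightarrow> real ^ 'd) set" where
  "vec_space V = {X. \<forall>j. (\<lambda>x. X x $ j) \<in> V}"

definition h2_unitary ::
    "real \<Rightarrow> 'a measure \<Rightarrow> (real \<times> 'a \<Rightarrow> 'b::euclidean_space) set
      \<Rightarrow> ((real \<times> 'a \<Rightarrow> 'b) \<Rightarrow> (real \<times> 'a \<Rightarrow> 'b)) \<Rightarrow> bool" where
  "h2_unitary T M H U \<longleftrightarrow>
     (\<forall>u\<in>H. U u \<in> H) \<and>
     (\<forall>u\<in>H. \<forall>v\<in>H. \<forall>a b. AE x in dt_P T M.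
        U (\<lambda>x. a *\<^sub>R u x + b *\<^sub>R v x) x = a *\<^sub>R U u x + b *\<^sub>R U v x) \<and>
     (\<forall>u\<in>H. \<forall>v\<in>H. h2_inner T M (U u) (U v) = h2_inner T M u v) \<and>
     (\<forall>v\<in>H. \<exists>u\<in>H. AE x in dt_P T M. U u x = v x)"

text \<open>Borel sigma-algebra on \<open>H\<close> of the topology given by the seminorm \<open>nrm\<close>.\<close>

definition norm_borel ::
    "('c \<Rightarrow> 'b::real_vector) set \<Rightarrow> (('c \<Rightarrow> 'b) \<Rightarrow> real) \<Rightarrow> ('c \<Rightarrow> 'b) measure" where
  "norm_borel H nrm =
     sigma H {G. G \<subseteq> H \<and> (\<forall>u\<in>G. \<exists>e>0. \<forall>v\<in>H. nrm (\<lambda>x. v x - u x) < e \<longrightarrow> v \<in> G)}"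

definition h2_borel ::
    "real \<Rightarrow> 'a measure \<Rightarrow> (real \<times> 'a \<Rightarrow> 'b::euclidean_space) set \<Rightarrow> (real \<times> 'a \<Rightarrow> 'b) measure" where
  "h2_borel T M H = norm_borel H (h2_norm T M)"

definition h2_sums ::
    "real \<Rightarrow> 'a measure \<Rightarrow> (nat \<Rightarrow> real \<times> 'a \<Rightarrow> 'b::euclidean_space) \<Rightarrow> (real \<times> 'a \<Rightarrow> 'b) \<Rightarrow> bool" where
  "h2_sums T M f u \<longleftrightarrow> (\<lambda>n. h2_norm T M (\<lambda>x. (\<Sum>k<n. f k x) - u x)) \<longlonglongrightarrow> 0"

text \<open>A representative of the sum; the value \<open>0\<close> is used where the series diverges.\<close>

definition h2_suminf ::
    "real \<Rightarrow> 'a measure \<Rightarrow> (real \<times> 'a \<Rightarrow> 'b::euclidean_space) set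
      \<Rightarrow> (nat \<Rightarrow> real \<times> 'a \<Rightarrow> 'b) \<Rightarrow> (real \<times> 'a \<Rightarrow> 'b)" where
  "h2_suminf T M H f =
     (if \<exists>u\<in>H. h2_sums T M f u then SOME u. u \<in> H \<and> h2_sums T M f u else (\<lambda>_. 0))"

section \<open>Chaoslets\<close>

definition hermite_He :: "nat \<Rightarrow> real \<Rightarrow> real" where
  "hermite_He n x = (-1) ^ n * exp (x\<^sup>2 / 2) * (deriv ^^ n) (\<lambda>y. exp (- (y\<^sup>2) / 2)) x"

definition hermite_h :: "nat \<Rightarrow> real \<Rightarrow> real" where
  "hermite_h n x = hermite_He n x / sqrt (fact n)"

definition haar :: "real \<Rightarrow> nat \<Rightarrow> nat \<Rightarrow> real \<Rightarrow> real" where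
  "haar T i k t = 2 powr (real i / 2) / sqrt T *
     (- indicator {T * real k / 2 ^ i ..< T * real (1 + 2 * k) / 2 ^ (i + 1)} t
      + indicator {T * real (1 + 2 * k) / 2 ^ (i + 1) ..< T * real (k + 1) / 2 ^ i} t)"

definition haar_coeff ::
    "real \<Rightarrow> (real \<Rightarrow> 'a \<Rightarrow> real ^ 'n) \<Rightarrow> nat \<Rightarrow> nat \<Rightarrow> 'n \<Rightarrow> 'a \<Rightarrow> real" where
  "haar_coeff T W i k r \<omega> = 2 powr (real i / 2) / sqrt T *
     (W (T * real k / 2 ^ i) \<omega> $ r - 2 * W (T * real (1 + 2 * k) / 2 ^ (i + 1)) \<omega> $ r
      + W (T * real (k + 1) / 2 ^ i) \<omega> $ r)"

definition past_index :: "nat \<Rightarrow> nat \<Rightarrow> (nat \<times> nat) set" where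
  "past_index p q = {(i, k). k < 2 ^ i \<and> real (k + 1) / 2 ^ i \<le> real q / 2 ^ p}"

text \<open>Chaoslets are indexed by labels: \<open>Constant\<close> for the process \<open>1 / sqrt T\<close> and
  \<open>Chaos p q \<alpha>\<close> otherwise, where \<open>\<alpha>\<close> is extended by \<open>0\<close> outside the index set.
  Products run over the support of \<open>\<alpha>\<close>, as \<open>prod\<close> over an infinite set is \<open>1\<close>.\<close>

datatype 'n chaos_label = Constant | Chaos nat nat "(nat \<times> nat) \<times> 'n \<Rightarrow> nat"

definition chaos_labels :: "'n chaos_label set" where
  "chaos_labels = insert Constant
     {Chaos p q \<alpha> | p q \<alpha>. q < 2 ^ p \<and> finite {z. \<alpha> z \<noteq> 0} \<and> {z. \<alpha> z \<noteq> 0} \<subseteq> past_index p q \<times> UNIV}"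

fun chaos_degree :: "'n chaos_label \<Rightarrow> nat" where
  "chaos_degree Constant = 0"
| "chaos_degree (Chaos p q \<alpha>) = (\<Sum>z | \<alpha> z \<noteq> 0. \<alpha> z)"

fun chaoslet ::
    "real \<Rightarrow> (real \<Rightarrow> 'a \<Rightarrow> real ^ 'n) \<Rightarrow> 'n chaos_label \<Rightarrow> real \<times> 'a \<Rightarrow> real" where
  "chaoslet T W Constant (t, \<omega>) = 1 / sqrt T"
| "chaoslet T W (Chaos p q \<alpha>) (t, \<omega>) = haar T p q t *
     (\<Prod>((i, k), r) | \<alpha> ((i, k), r) \<noteq> 0. hermite_h (\<alpha> ((i, k), r)) (haar_coeff T W i k r \<omega>))"

definition vec_chaoslet ::
    "real \<Rightarrow> (real \<Rightarrow> 'a \<Rightarrow> real ^ 'n) \<Rightarrow> 'n chaos_label \<times> 'd \<Rightarrow> real \<times> 'a \<Rightarrow> real ^ 'd" where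
  "vec_chaoslet T W = (\<lambda>(l, j) x. chaoslet T W l x *\<^sub>R axis j 1)"

section \<open>Malliavin--Sobolev space\<close>

text \<open>Throughout, \<open>V\<close> is the closed subspace of \<open>h2 T M W\<close> in which the chaoslets are an
  orthonormal basis; \<open>V = h2 T M W\<close> is admitted. A proper subspace is admitted too because, for the
  index sets above, processes such as \<open>(t, \<omega>) \<mapsto> indicator {T/2..<T} t * W (T/4) \<omega> $ r\<close> are
  orthogonal to every chaoslet.\<close>

definition chaos_proj ::
    "real \<Rightarrow> 'a measure \<Rightarrow> (real \<Rightarrow> 'a \<Rightarrow> real ^ 'n) \<Rightarrow> nat \<Rightarrow> (real \<times> 'a \<Rightarrow> real)
      \<Rightarrow> (real \<times> 'a \<Rightarrow> real)" where
  "chaos_proj T M W n =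
     h2_proj T M (h2_closed_span T M W (chaoslet T W) {l \<in> chaos_labels. chaos_degree l = n})"

definition sobolev ::
    "real \<Rightarrow> 'a measure \<Rightarrow> (real \<Rightarrow> 'a \<Rightarrow> real ^ 'n) \<Rightarrow> (real \<times> 'a \<Rightarrow> real) set \<Rightarrow> nat
      \<Rightarrow> (real \<times> 'a \<Rightarrow> real) set" where
  "sobolev T M W V s =
     {X \<in> V. summable (\<lambda>n. (1 + real n) ^ s * (h2_norm T M (chaos_proj T M W n X))\<^sup>2)}"

definition sobolev_norm ::
    "real \<Rightarrow> 'a measure \<Rightarrow> (real \<Rightarrow> 'a \<Rightarrow> real ^ 'n) \<Rightarrow> nat \<Rightarrow> (real \<times> 'a \<Rightarrow> real ^ 'd) \<Rightarrow> real" where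
  "sobolev_norm T M W s X =
     sqrt (\<Sum>j\<in>UNIV. \<Sum>n. (1 + real n) ^ s * (h2_norm T M (chaos_proj T M W n (\<lambda>x. X x $ j)))\<^sup>2)"

section \<open>Compressibility and best approximation\<close>

definition chaos_coeff ::
    "real \<Rightarrow> 'a measure \<Rightarrow> (real \<Rightarrow> 'a \<Rightarrow> real ^ 'n) \<Rightarrow> (real \<times> 'a \<Rightarrow> real ^ 'd) \<Rightarrow> 'n chaos_label
      \<Rightarrow> real ^ 'd" where
  "chaos_coeff T M W X l = (\<chi> j. h2_inner T M (\<lambda>x. X x $ j) (chaoslet T W l))"

definition rearrangement :: "('i \<Rightarrow> real) \<Rightarrow> 'i set \<Rightarrow> nat \<Rightarrow> real" where
  "rearrangement f I r = Inf {y. 0 \<le> y \<and> finite {l \<in> I. y < f l} \<and> card {l \<in> I. y < f l} < r}"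

definition compressible ::
    "real \<Rightarrow> 'a measure \<Rightarrow> (real \<Rightarrow> 'a \<Rightarrow> real ^ 'n) \<Rightarrow> real \<Rightarrow> (real \<times> 'a \<Rightarrow> real ^ 'd) \<Rightarrow> bool" where
  "compressible T M W S X \<longleftrightarrow>
     (\<exists>C>0. \<forall>r\<ge>1. rearrangement (\<lambda>l. norm (chaos_coeff T M W X l)) chaos_labels r \<le> C * real r powr (- S))"

definition best_N_term_error ::
    "real \<Rightarrow> 'a measure \<Rightarrow> (real \<Rightarrow> 'a \<Rightarrow> real ^ 'n) \<Rightarrow> (real \<times> 'a \<Rightarrow> real ^ 'd) \<Rightarrow> nat \<Rightarrow> real" where
  "best_N_term_error T M W X N =
     Inf {h2_norm T M (\<lambda>x. X x - (\<Sum>n<N. chaoslet T W (m n) x *\<^sub>R \<beta> n)) | m \<beta>.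
            \<forall>n<N. m n \<in> chaos_labels}"

section \<open>Sequence spaces, sub-Gaussian variables, the random series\<close>

definition lp_space :: "real \<Rightarrow> (nat \<Rightarrow> real) set" where
  "lp_space p = {a. summable (\<lambda>k. \<bar>a k\<bar> powr p)}"

definition lp_norm :: "real \<Rightarrow> (nat \<Rightarrow> real) \<Rightarrow> real" where
  "lp_norm p a = (\<Sum>k. \<bar>a k\<bar> powr p) powr (1 / p)"

definition weighted_l2 :: "(nat \<Rightarrow> nat) \<Rightarrow> nat \<Rightarrow> (nat \<Rightarrow> real) set" where
  "weighted_l2 dg s = {a. summable (\<lambda>k. (1 + real (dg k)) ^ s * \<bar>a k\<bar>\<^sup>2)}"

definition weighted_l2_norm :: "(nat \<Rightarrow> nat) \<Rightarrow> nat \<Rightarrow> (nat \<Rightarrow> real) \<Rightarrow> real" where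
  "weighted_l2_norm dg s a = sqrt (\<Sum>k. (1 + real (dg k)) ^ s * \<bar>a k\<bar>\<^sup>2)"

definition bounded_matrix_on ::
    "(nat \<Rightarrow> real) set \<Rightarrow> ((nat \<Rightarrow> real) \<Rightarrow> real) \<Rightarrow> (nat \<Rightarrow> nat \<Rightarrow> real) \<Rightarrow> bool" where
  "bounded_matrix_on E nrm A \<longleftrightarrow>
     (\<forall>a\<in>E. (\<forall>m. summable (\<lambda>n. A m n * a n)) \<and> (\<lambda>m. \<Sum>n. A m n * a n) \<in> E) \<and>
     (\<exists>C. \<forall>a\<in>E. nrm (\<lambda>m. \<Sum>n. A m n * a n) \<le> C * nrm a)"

definition unitary_matrix ::
    "real \<Rightarrow> 'a measure \<Rightarrow> ((real \<times> 'a \<Rightarrow> 'b::euclidean_space) \<Rightarrow> (real \<times> 'a \<Rightarrow> 'b))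
      \<Rightarrow> (nat \<Rightarrow> real \<times> 'a \<Rightarrow> 'b) \<Rightarrow> nat \<Rightarrow> nat \<Rightarrow> real" where
  "unitary_matrix T M U \<phi> m n = h2_inner T M (U (\<phi> n)) (\<phi> m)"

definition sub_gaussian :: "'w measure \<Rightarrow> ('w \<Rightarrow> real) \<Rightarrow> bool" where
  "sub_gaussian N \<xi> \<longleftrightarrow> \<xi> \<in> borel_measurable N \<and>
     (\<exists>K>0. (\<integral>\<^sup>+ \<omega>. ennreal (exp ((\<xi> \<omega>)\<^sup>2 / K\<^sup>2)) \<partial>N) \<le> 2)"

definition series_term ::
    "(nat \<Rightarrow> real) \<Rightarrow> (nat \<Rightarrow> 'w \<Rightarrow> real) \<Rightarrow> ((real \<times> 'a \<Rightarrow> 'b::euclidean_space) \<Rightarrow> (real \<times> 'a \<Rightarrow> 'b))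
      \<Rightarrow> (nat \<Rightarrow> real \<times> 'a \<Rightarrow> 'b) \<Rightarrow> 'w \<Rightarrow> nat \<Rightarrow> real \<times> 'a \<Rightarrow> 'b" where
  "series_term \<theta> \<xi> U \<phi> w k x = (\<theta> k * \<xi> k w) *\<^sub>R U (\<phi> k) x"

definition random_series ::
    "real \<Rightarrow> 'a measure \<Rightarrow> (real \<times> 'a \<Rightarrow> 'b::euclidean_space) set \<Rightarrow> (nat \<Rightarrow> real)
      \<Rightarrow> (nat \<Rightarrow> 'w \<Rightarrow> real) \<Rightarrow> ((real \<times> 'a \<Rightarrow> 'b) \<Rightarrow> (real \<times> 'a \<Rightarrow> 'b))
      \<Rightarrow> (nat \<Rightarrow> real \<times> 'a \<Rightarrow> 'b) \<Rightarrow> 'w \<Rightarrow> real \<times> 'a \<Rightarrow> 'b" where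
  "random_series T M H \<theta> \<xi> U \<phi> w = h2_suminf T M H (series_term \<theta> \<xi> U \<phi> w)"

definition series_law ::
    "'w measure \<Rightarrow> real \<Rightarrow> 'a measure \<Rightarrow> (real \<times> 'a \<Rightarrow> 'b::euclidean_space) set \<Rightarrow> (nat \<Rightarrow> real)
      \<Rightarrow> (nat \<Rightarrow> 'w \<Rightarrow> real) \<Rightarrow> ((real \<times> 'a \<Rightarrow> 'b) \<Rightarrow> (real \<times> 'a \<Rightarrow> 'b))
      \<Rightarrow> (nat \<Rightarrow> real \<times> 'a \<Rightarrow> 'b) \<Rightarrow> (real \<times> 'a \<Rightarrow> 'b) measure" where
  "series_law N T M H \<theta> \<xi> U \<phi> = distr N (h2_borel T M H) (random_series T M H \<theta> \<xi> U \<phi>)"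

section \<open>The whole space is an admissible choice of \<open>V\<close>\<close>

lemma null_augmented_subset:
  fixes W :: "real \<Rightarrow> 'a \<Rightarrow> real ^ 'n"
  assumes "\<And>u. u \<in> {0..T} \<Longrightarrow> W u \<in> borel_measurable M" and "t \<le> T"
  shows "null_augmented M W t \<subseteq> sets M"
  unfolding null_augmented_def using assms
  by (intro sets.sigma_sets_subset) (auto intro!: measurable_sets)

lemma usual_filtration_subset:
  fixes W :: "real \<Rightarrow> 'a \<Rightarrow> real ^ 'n"
  assumes "\<And>u. u \<in> {0..T} \<Longrightarrow> W u \<in> borel_measurable M"
  shows "usual_filtration T M W t \<subseteq> sets M"
  using null_augmented_subset[of T W M T, OF assms] by (auto simp: usual_filtration_def)

lemma predictable_measurable_dt_P:
  fixes W :: "real \<Rightarrow> 'a \<Rightarrow> real ^ 'n"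
  assumes W: "\<And>u. u \<in> {0..T} \<Longrightarrow> W u \<in> borel_measurable M"
    and f: "f \<in> borel_measurable (predictable T M W)"
  shows "f \<in> borel_measurable (dt_P T M)"
proof -
  have rect: "B \<times> A \<in> sets (dt_P T M)" if "B \<in> sets lborel" "B \<subseteq> {0..T}" "A \<in> sets M" for A B
    unfolding dt_P_def using that
    by (intro pair_measureI) (auto simp: sets_restrict_space_iff)
  have gen: "{{0} \<times> A | A. A \<in> usual_filtration T M W 0} \<union>
        {{s<..t} \<times> A | s t A. 0 \<le> s \<and> s < t \<and> t \<le> T \<and> A \<in> usual_filtration T M W s}
        \<subseteq> sets (dt_P T M)" if "0 \<le> T"
    using usual_filtration_subset[of T W M, OF W] that by (auto intro!: rect)
  have sp: "space (dt_P T M) = {0..T} \<times> space M"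
    by (simp add: dt_P_def space_pair_measure space_restrict_space)
  show ?thesis
  proof (cases "0 \<le> T")
    case True
    have "sets (predictable T M W) \<subseteq> sets (dt_P T M)"
      unfolding predictable_def sp[symmetric] sets_measure_of_conv
      using sets.sigma_sets_subset[OF gen[OF True]] sets.empty_sets sets.top
      by auto
    moreover have "space (predictable T M W) = space (dt_P T M)"
      by (simp add: predictable_def space_measure_of_conv sp)
    ultimately show ?thesis
      using f by (auto simp: measurable_def)
  next
    case False
    then have "space (dt_P T M) = {}" by (simp add: sp)
    then show ?thesis by (auto simp: measurable_def)
  qed
qed

lemma h2_lincomb:
  fixes u v :: "real \<times> 'a \<Rightarrow> real" and W :: "real \<Rightarrow> 'a \<Rightarrow> real ^ 'n"
  assumes W: "\<And>t. t \<in> {0..T} \<Longrightarrow> W t \<in> borel_measurable M"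
    and u: "u \<in> h2 T M W" and v: "v \<in> h2 T M W"
  shows "(\<lambda>x. a * u x + b * v x) \<in> h2 T M W"
proof -
  have m: "u \<in> borel_measurable (predictable T M W)" "v \<in> borel_measurable (predictable T M W)"
    using u v by (auto simp: h2_def)
  have md: "u \<in> borel_measurable (dt_P T M)" "v \<in> borel_measurable (dt_P T M)"
    using m predictable_measurable_dt_P[of T W M, OF W] by auto
  have "integrable (dt_P T M) (\<lambda>x. (norm (a * u x + b * v x))\<^sup>2)"
  proof (rule Bochner_Integration.integrable_bound)
    show "integrable (dt_P T M) (\<lambda>x. 2 * a\<^sup>2 * (norm (u x))\<^sup>2 + 2 * b\<^sup>2 * (norm (v x))\<^sup>2)"
      using u v by (auto simp: h2_def)
    show "AE x in dt_P T M. norm ((norm (a * u x + b * v x))\<^sup>2)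
        \<le> norm (2 * a\<^sup>2 * (norm (u x))\<^sup>2 + 2 * b\<^sup>2 * (norm (v x))\<^sup>2)"
    proof (intro AE_I2)
      fix x
      have "(a * u x + b * v x)\<^sup>2 \<le> 2 * a\<^sup>2 * (u x)\<^sup>2 + 2 * b\<^sup>2 * (v x)\<^sup>2"
        using zero_le_power2[of "a * u x - b * v x"]
        by (simp add: power2_sum power2_diff power_mult_distrib)
      then show "norm ((norm (a * u x + b * v x))\<^sup>2)
        \<le> norm (2 * a\<^sup>2 * (norm (u x))\<^sup>2 + 2 * b\<^sup>2 * (norm (v x))\<^sup>2)"
        by simp
    qed
  qed (use md in measurable)
  then show ?thesis
    using m by (auto simp: h2_def)
qed

lemma h2_closed_subspace_h2:
  assumes "brownian_motion T M W"
  shows "h2_closed_subspace T M W (h2 T M W)"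
  using assms h2_lincomb[of T W M]
  by (auto simp: h2_closed_subspace_def brownian_motion_def) (simp add: h2_def)

lemma vec_space_h2:
  assumes "brownian_motion T M W"
  shows "vec_space (h2 T M W) = (h2 T M W :: (real \<times> 'a \<Rightarrow> real ^ 'd) set)"
proof (intro set_eqI iffI)
  have W: "\<And>t. t \<in> {0..T} \<Longrightarrow> W t \<in> borel_measurable M"
    using assms by (auto simp: brownian_motion_def)
  fix X :: "real \<times> 'a \<Rightarrow> real ^ 'd"
  have sq: "(norm (X x))\<^sup>2 = (\<Sum>j\<in>UNIV. (norm (X x $ j))\<^sup>2)" for x
    by (simp add: norm_vec_def L2_set_def sum_nonneg)
  have comp: "X \<in> borel_measurable K \<longleftrightarrow> (\<forall>j. (\<lambda>x. X x $ j) \<in> borel_measurable K)"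
    for K :: "(real \<times> 'a) measure"
    by (subst borel_measurable_euclidean_space) (auto simp: Basis_vec_def inner_axis)
  show "X \<in> h2 T M W" if "X \<in> vec_space (h2 T M W)"
    using that by (auto simp: h2_def vec_space_def comp sq)
  show "X \<in> vec_space (h2 T M W)" if X: "X \<in> h2 T M W"
  proof -
    have m: "X \<in> borel_measurable (predictable T M W)" using X by (simp add: h2_def)
    have "integrable (dt_P T M) (\<lambda>x. (norm (X x $ j))\<^sup>2)" for j
    proof (rule Bochner_Integration.integrable_bound)
      show "integrable (dt_P T M) (\<lambda>x. (norm (X x))\<^sup>2)" using X by (simp add: h2_def)
      have "(\<lambda>x. X x $ j) \<in> borel_measurable (dt_P T M)"
        using predictable_measurable_dt_P[of T W M, OF W] m[unfolded comp] by blast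
      then show "(\<lambda>x. (norm (X x $ j))\<^sup>2) \<in> borel_measurable (dt_P T M)" by measurable
      show "AE x in dt_P T M. norm ((norm (X x $ j))\<^sup>2) \<le> norm ((norm (X x))\<^sup>2)"
        by (intro AE_I2) (simp add: component_le_norm_cart flip: abs_le_square_iff)
    qed
    then show ?thesis using m by (auto simp: h2_def vec_space_def comp)
  qed
qed

end

theory Submission
  imports Defs
begin

text \<open>Parseval's identity for the chaoslets turns every object into a statement about the coordinate
  sequence of a process: the \<open>\<H>\<^sup>2\<close>-norm becomes the \<open>\<ell>\<^sup>2\<close>-norm, the Sobolev norm a weighted
  \<open>\<ell>\<^sup>2\<close>-norm, and both Borel sigma-algebras are generated by the coordinates. Since
  \<open>E \<bar>\<xi>\<^sub>k\<bar>\<^sup>p \<le> 1 + E \<xi>\<^sub>k\<^sup>2 = 2\<close>, the sequence \<open>(\<theta>\<^sub>k \<xi>\<^sub>k)\<close> almost surely lies in \<open>\<ell>\<^sup>p\<close> and in the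
  weighted \<open>\<ell>\<^sup>2\<close>, hence so does its image under the matrix of \<open>U\<close>, which is the coordinate
  sequence of the random series. An \<open>\<ell>\<^sup>p\<close> sequence is in weak \<open>\<ell>\<^sup>p\<close>, which is compressibility,
  and keeping the coefficients above the level \<open>C N\<^bsup>-1/p\<^esup>\<close> leaves a squared error of at most
  \<open>(C N\<^bsup>-1/p\<^esup>)\<^bsup>2-p\<^esup> C\<^sup>p = C\<^sup>2 N\<^bsup>-(2/p-1)\<^esup>\<close>.\<close>

section \<open>Square-integrable predictable processes\<close>

text \<open>Two features shape the argument. The sum of the series is a representative picked by
  Hilbert choice, with default 0 where the series diverges, so its values give no direct access to
  measurability in the random parameter. Its coordinates do not depend on the representative and are
  measurable numerical series; since the Borel sigma-algebra on \<open>H\<close> is the pullback of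
  the product sigma-algebra under \<open>coord\<close>, this makes the series a random element. The
  Sobolev weights change the topology but not the pullback, which is why the law can be read as a
  Borel measure on the Sobolev space. Moreover, functions are not identified almost everywhere and
  \<open>U\<close> is linear only up to null sets. \<open>U\<close> is therefore never moved through
  a sum: it enters through the orthonormal family \<open>U (\<phi> k)\<close> and through the matrix
  that produces the coordinates.\<close>

locale h2_space =
  fixes T :: real and M :: "'a measure" and W :: "real \<Rightarrow> 'a \<Rightarrow> real ^ 'n"
  assumes T_pos: "T > 0"
    and prob_space_M: "prob_space M"
    and brownian: "brownian_motion T M W"
begin

lemma W_measurable: "t \<in> {0..T} \<Longrightarrow> W t \<in> borel_measurable M"
  using brownian by (auto simp: brownian_motion_def)

text \<open>The total mass is T. On a finite measure the constant 1 is square-integrable, so the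
  seminorm controls the L1 norm; the completeness argument relies on this.\<close>

lemma finite_measure_dt_P: "finite_measure (dt_P T M)"
proof
  interpret prob_space M by (rule prob_space_M)
  have "emeasure (restrict_space lborel {0..T}) {0..T} = T"
    using T_pos by (simp add: emeasure_restrict_space)
  then have "emeasure (dt_P T M) ({0..T} \<times> space M) = T"
    unfolding dt_P_def
    by (subst emeasure_pair_measure_Times)
       (auto simp: sets_restrict_space_iff emeasure_space_1)
  then show "emeasure (dt_P T M) (space (dt_P T M)) \<noteq> \<infinity>"
    by (simp add: dt_P_def space_pair_measure space_restrict_space)
qed

lemma h2_predictable: "u \<in> h2 T M W \<Longrightarrow> u \<in> borel_measurable (predictable T M W)"
  by (simp add: h2_def)

lemma h2_measurable: "u \<in> h2 T M W \<Longrightarrow> u \<in> borel_measurable (dt_P T M)"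
  by (auto intro!: predictable_measurable_dt_P[OF W_measurable] h2_predictable)

lemma h2_integrable_norm: "u \<in> h2 T M W \<Longrightarrow> integrable (dt_P T M) (\<lambda>x. (norm (u x))\<^sup>2)"
  by (simp add: h2_def)

lemma h2_integrable_inner:
  assumes "u \<in> h2 T M W" and "v \<in> h2 T M W"
  shows "integrable (dt_P T M) (\<lambda>x. u x \<bullet> v x)"
proof (rule Bochner_Integration.integrable_bound)
  show "integrable (dt_P T M) (\<lambda>x. (norm (u x))\<^sup>2 + (norm (v x))\<^sup>2)"
    using assms by (intro Bochner_Integration.integrable_add h2_integrable_norm)
  show "(\<lambda>x. u x \<bullet> v x) \<in> borel_measurable (dt_P T M)"
    using assms by (intro borel_measurable_inner h2_measurable)
  show "AE x in dt_P T M. norm (u x \<bullet> v x) \<le> norm ((norm (u x))\<^sup>2 + (norm (v x))\<^sup>2)"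
  proof (intro AE_I2)
    fix x
    have "\<bar>u x \<bullet> v x\<bar> \<le> norm (u x) * norm (v x)"
      by (rule Cauchy_Schwarz_ineq2)
    also have "\<dots> \<le> (norm (u x))\<^sup>2 + (norm (v x))\<^sup>2"
      using sum_squares_bound[of "norm (u x)" "norm (v x)"]
        mult_nonneg_nonneg[OF norm_ge_zero[of "u x"] norm_ge_zero[of "v x"]] by linarith
    finally show "norm (u x \<bullet> v x) \<le> norm ((norm (u x))\<^sup>2 + (norm (v x))\<^sup>2)"
      by simp
  qed
qed

lemma h2_zero: "(\<lambda>_. 0) \<in> h2 T M W"
  by (simp add: h2_def)

lemma h2_add:
  assumes "u \<in> h2 T M W" and "v \<in> h2 T M W"
  shows "(\<lambda>x. u x + v x) \<in> h2 T M W"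
proof -
  have "integrable (dt_P T M) (\<lambda>x. (norm (u x))\<^sup>2 + 2 * (u x \<bullet> v x) + (norm (v x))\<^sup>2)"
    using assms by (intro Bochner_Integration.integrable_add h2_integrable_norm
        h2_integrable_inner integrable_mult_right)
  moreover have "(norm (u x + v x))\<^sup>2 = (norm (u x))\<^sup>2 + 2 * (u x \<bullet> v x) + (norm (v x))\<^sup>2" for x
    by (simp add: power2_norm_eq_inner inner_add inner_commute)
  moreover have "(\<lambda>x. u x + v x) \<in> borel_measurable (predictable T M W)"
    using assms by (intro borel_measurable_add h2_predictable)
  ultimately show ?thesis
    by (simp add: h2_def)
qed

lemma h2_scaleR: "u \<in> h2 T M W \<Longrightarrow> (\<lambda>x. a *\<^sub>R u x) \<in> h2 T M W"
  by (simp add: h2_def power_mult_distrib borel_measurable_scaleR)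

lemma h2_diff:
  assumes "u \<in> h2 T M W" and "v \<in> h2 T M W"
  shows "(\<lambda>x. u x - v x) \<in> h2 T M W"
  using h2_add[OF assms(1) h2_scaleR[OF assms(2), of "-1"]] by simp

lemma h2_sum: "(\<And>i. i \<in> I \<Longrightarrow> f i \<in> h2 T M W) \<Longrightarrow> (\<lambda>x. \<Sum>i\<in>I. f i x) \<in> h2 T M W"
  by (induction I rule: infinite_finite_induct) (auto intro: h2_zero h2_add)

lemma h2_inner_commute: "h2_inner T M u v = h2_inner T M v u"
  by (simp add: h2_inner_def inner_commute)

lemma h2_inner_diff_left:
  assumes "u \<in> h2 T M W" "v \<in> h2 T M W" "z \<in> h2 T M W"
  shows "h2_inner T M (\<lambda>x. u x - v x) z = h2_inner T M u z - h2_inner T M v z"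
  using assms by (simp add: h2_inner_def inner_diff_left h2_integrable_inner)

lemma h2_inner_scaleR_left: "h2_inner T M (\<lambda>x. a *\<^sub>R u x) z = a * h2_inner T M u z"
  by (simp add: h2_inner_def)

lemma h2_inner_zero_left [simp]: "h2_inner T M (\<lambda>_. 0) z = 0"
  by (simp add: h2_inner_def)

lemma h2_inner_zero_right [simp]: "h2_inner T M z (\<lambda>_. 0) = 0"
  by (simp add: h2_inner_def)

lemma h2_inner_sum_left:
  assumes "\<And>i. i \<in> I \<Longrightarrow> f i \<in> h2 T M W" "z \<in> h2 T M W"
  shows "h2_inner T M (\<lambda>x. \<Sum>i\<in>I. f i x) z = (\<Sum>i\<in>I. h2_inner T M (f i) z)"
  using assms by (simp add: h2_inner_def inner_sum_left h2_integrable_inner)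

lemma h2_inner_nonneg: "0 \<le> h2_inner T M u u"
  by (simp add: h2_inner_def)

lemma h2_norm_nonneg [simp]: "0 \<le> h2_norm T M u"
  by (simp add: h2_norm_def h2_inner_nonneg)

lemma h2_norm_power2: "(h2_norm T M u)\<^sup>2 = h2_inner T M u u"
  by (simp add: h2_norm_def h2_inner_nonneg)

lemma h2_norm_diff_power2:
  assumes "u \<in> h2 T M W" "v \<in> h2 T M W"
  shows "(h2_norm T M (\<lambda>x. u x - v x))\<^sup>2
    = (h2_norm T M u)\<^sup>2 - 2 * h2_inner T M u v + (h2_norm T M v)\<^sup>2"
proof -
  have "h2_inner T M z (\<lambda>x. u x - v x) = h2_inner T M z u - h2_inner T M z v"
    if "z \<in> h2 T M W" for z
    using assms that by (simp only: h2_inner_commute[of z] h2_inner_diff_left)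
  then show ?thesis
    using assms h2_inner_commute[of v u]
    by (simp add: h2_norm_power2 h2_inner_diff_left h2_diff)
qed

lemma h2_norm_minus_commute: "h2_norm T M (\<lambda>x. u x - v x) = h2_norm T M (\<lambda>x. v x - u x)"
  by (simp add: h2_norm_def h2_inner_def norm_minus_commute flip: power2_norm_eq_inner)

text \<open>The quadratic polynomial t -> |u - t v|^2 is nonnegative, so its discriminant is not
  positive. As |.| is a seminorm, |v| = 0 has to be treated separately.\<close>

lemma h2_Cauchy_Schwarz:
  assumes "u \<in> h2 T M W" "v \<in> h2 T M W"
  shows "\<bar>h2_inner T M u v\<bar> \<le> h2_norm T M u * h2_norm T M v"
proof -
  let ?a = "h2_inner T M u u" and ?b = "h2_inner T M u v" and ?c = "h2_inner T M v v"
  have nonneg: "0 \<le> ?a - 2 * t * ?b + t\<^sup>2 * ?c" for t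
  proof -
    have "0 \<le> (h2_norm T M (\<lambda>x. u x - t *\<^sub>R v x))\<^sup>2" by simp
    also have "\<dots> = ?a - 2 * t * ?b + t\<^sup>2 * ?c"
      using assms by (subst h2_norm_diff_power2)
        (auto simp: h2_norm_power2 h2_scaleR h2_inner_scaleR_left power2_eq_square[of t]
          h2_inner_commute[of _ "\<lambda>x. t *\<^sub>R v x"] h2_inner_commute[of v u])
    finally show ?thesis .
  qed
  have "?b\<^sup>2 \<le> ?a * ?c"
  proof (cases "?c = 0")
    case True
    \<comment> \<open>With \<open>?c = 0\<close> the polynomial is affine in t; were
      \<open>?b\<close> nonzero, its value at the chosen t would be -1.\<close>
    have "?b = 0"
      using nonneg[of "(?a + 1) / (2 * ?b)"] by (cases "?b = 0") (auto simp: True)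
    then show ?thesis by (simp add: True)
  next
    case False
    then have "?c > 0" using h2_inner_nonneg[of v] by simp
    then show ?thesis
      using nonneg[of "?b / ?c"] by (simp add: field_simps power2_eq_square)
  qed
  then have "sqrt (?b\<^sup>2) \<le> sqrt (?a * ?c)" by (rule real_sqrt_le_mono)
  then show ?thesis by (simp add: h2_norm_def real_sqrt_mult)
qed

lemma h2_inner_tendsto:
  assumes S: "\<And>n. S n \<in> h2 T M W" and u: "u \<in> h2 T M W" and v: "v \<in> h2 T M W"
    and lim: "(\<lambda>n. h2_norm T M (\<lambda>x. S n x - u x)) \<longlonglongrightarrow> 0"
  shows "(\<lambda>n. h2_inner T M (S n) v) \<longlonglongrightarrow> h2_inner T M u v"
proof -
  have "(\<lambda>n. h2_inner T M (S n) v - h2_inner T M u v) \<longlonglongrightarrow> 0"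
  proof (rule Lim_null_comparison[OF always_eventually], rule allI)
    show "norm (h2_inner T M (S n) v - h2_inner T M u v)
        \<le> h2_norm T M (\<lambda>x. S n x - u x) * h2_norm T M v" for n
      using h2_Cauchy_Schwarz[OF h2_diff[OF S u] v, of n] by (simp add: h2_inner_diff_left[OF S u v])
    show "(\<lambda>n. h2_norm T M (\<lambda>x. S n x - u x) * h2_norm T M v) \<longlonglongrightarrow> 0"
      using tendsto_mult[OF lim tendsto_const] by simp
  qed
  then show ?thesis by (simp add: LIM_zero_iff)
qed

text \<open>The limit is taken along an almost everywhere convergent subsequence of the functions
  themselves, so that it is predictable and not merely measurable for the product sigma-algebra.\<close>

lemma h2_complete:
  fixes S :: "nat \<Rightarrow> real \<times> 'a \<Rightarrow> 'b::euclidean_space"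
  assumes S: "\<And>n. S n \<in> h2 T M W"
    and Cauchy: "\<And>e. e > 0 \<Longrightarrow> \<exists>N. \<forall>i\<ge>N. \<forall>j\<ge>N. h2_norm T M (\<lambda>x. S i x - S j x) < e"
  shows "\<exists>u\<in>h2 T M W. (\<lambda>n. h2_norm T M (\<lambda>x. S n x - u x)) \<longlonglongrightarrow> 0"
proof -
  interpret P: finite_measure "dt_P T M" by (rule finite_measure_dt_P)
  have meas [measurable]: "S n \<in> borel_measurable (dt_P T M)" for n
    by (rule h2_measurable[OF S])
  have one: "(\<lambda>_. 1 :: real) \<in> h2 T M W"
    by (simp add: h2_def)
  have abs: "(\<lambda>x. norm (v x)) \<in> h2 T M W"
    if "v \<in> h2 T M W" for v :: "real \<times> 'a \<Rightarrow> 'b"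
    using that measurable_compose[OF h2_predictable[OF that] borel_measurable_norm] by (auto simp: h2_def)
  have L1_le: "(LINT x|dt_P T M. norm (v x)) \<le> h2_norm T M v * h2_norm T M (\<lambda>_. 1 :: real)"
    if "v \<in> h2 T M W" for v :: "real \<times> 'a \<Rightarrow> 'b"
  proof -
    have "h2_norm T M (\<lambda>x. norm (v x)) = h2_norm T M v"
      unfolding h2_norm_def h2_inner_def by (simp only: inner_real_def dot_square_norm power2_eq_square)
    then show ?thesis
      using h2_Cauchy_Schwarz[OF abs[OF that] one] by (simp add: h2_inner_def)
  qed
  have L1: "integrable (dt_P T M) v" if "v \<in> h2 T M W" for v :: "real \<times> 'a \<Rightarrow> 'b"
    using h2_integrable_inner[OF abs[OF that] one] h2_measurable[OF that]
    by (simp add: integrable_norm_iff inner_real_def)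
  have "\<exists>N. \<forall>i\<ge>N. \<forall>j\<ge>N. (LINT x|dt_P T M. norm (S i x - S j x)) < e" if "e > 0" for e
  proof -
    let ?K = "h2_norm T M (\<lambda>_. 1 :: real) + 1"
    have K: "?K > 0"
      using h2_norm_nonneg[of "\<lambda>_. 1 :: real"] by linarith
    obtain N where N: "\<And>i j. i \<ge> N \<Longrightarrow> j \<ge> N \<Longrightarrow> h2_norm T M (\<lambda>x. S i x - S j x) < e / ?K"
      using Cauchy[of "e / ?K"] K \<open>e > 0\<close> by auto
    have "(LINT x|dt_P T M. norm (S i x - S j x)) < e" if "i \<ge> N" "j \<ge> N" for i j
    proof -
      have "(LINT x|dt_P T M. norm (S i x - S j x)) \<le> h2_norm T M (\<lambda>x. S i x - S j x) * ?K"
        using L1_le[OF h2_diff[OF S S], of i j] h2_norm_nonneg[of "\<lambda>x. S i x - S j x"]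
        unfolding distrib_left by linarith
      also have "\<dots> < e"
        using N[OF that] K by (simp add: field_simps)
      finally show ?thesis .
    qed
    then show ?thesis by blast
  qed
  \<comment> \<open>The L1 bound serves to extract an almost everywhere Cauchy subsequence; the
    squared norm returns with Fatou below.\<close>
  then obtain r where r: "strict_mono r" "AE x in dt_P T M. Cauchy (\<lambda>i. S (r i) x)"
    using cauchy_L1_AE_cauchy_subseq[of "dt_P T M" S, OF L1[OF S]] by blast
  define u where "u x = lim (\<lambda>i. S (r i) x)" for x
  have u_pred: "u \<in> borel_measurable (predictable T M W)"
    unfolding u_def by (intro borel_measurable_lim_metric h2_predictable S)
  then have u_meas [measurable]: "u \<in> borel_measurable (dt_P T M)"
    by (intro predictable_measurable_dt_P[OF W_measurable])
  have lim: "AE x in dt_P T M. (\<lambda>i. S (r i) x) \<longlonglongrightarrow> u x"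
    using r(2) by eventually_elim (auto simp: u_def Cauchy_convergent_iff convergent_LIMSEQ_iff)
  have nn: "(\<integral>\<^sup>+x. ennreal ((norm (v x))\<^sup>2) \<partial>dt_P T M) = ennreal ((h2_norm T M v)\<^sup>2)"
    if "v \<in> h2 T M W" for v :: "real \<times> 'a \<Rightarrow> 'b"
    using nn_integral_eq_integral[OF h2_integrable_norm[OF that]]
    by (simp add: h2_norm_power2 h2_inner_def power2_norm_eq_inner)
  \<comment> \<open>The Cauchy estimate bounds \<open>S m - S (r i)\<close> for all large i at once;
    Fatou along the subsequence hands the bound \<open>e\<close> to \<open>S m - u\<close>.\<close>
  have Fatou: "(\<integral>\<^sup>+x. ennreal ((norm (S m x - u x))\<^sup>2) \<partial>dt_P T M) \<le> ennreal (e\<^sup>2)"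
    if e: "e > 0" and N: "\<And>i j. i \<ge> N \<Longrightarrow> j \<ge> N \<Longrightarrow> h2_norm T M (\<lambda>x. S i x - S j x) < e" and "m \<ge> N"
    for e N m
  proof -
    have "(\<integral>\<^sup>+x. ennreal ((norm (S m x - u x))\<^sup>2) \<partial>dt_P T M)
        = (\<integral>\<^sup>+x. liminf (\<lambda>i. ennreal ((norm (S m x - S (r i) x))\<^sup>2)) \<partial>dt_P T M)"
    proof (rule nn_integral_cong_AE, use lim in eventually_elim)
      case (elim x)
      then have "(\<lambda>i. ennreal ((norm (S m x - S (r i) x))\<^sup>2)) \<longlonglongrightarrow> ennreal ((norm (S m x - u x))\<^sup>2)"
        by (intro tendsto_ennrealI tendsto_power tendsto_norm tendsto_diff tendsto_const)
      then show ?case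
        by (rule lim_imp_Liminf[OF trivial_limit_sequentially, symmetric])
    qed
    also have "\<dots> \<le> liminf (\<lambda>i. \<integral>\<^sup>+x. ennreal ((norm (S m x - S (r i) x))\<^sup>2) \<partial>dt_P T M)"
      by (rule nn_integral_liminf) simp
    also have "\<dots> \<le> liminf (\<lambda>i. ennreal (e\<^sup>2))"
    proof (rule Liminf_mono, unfold eventually_sequentially, intro exI allI impI)
      fix i assume "N \<le> i"
      then have "N \<le> r i" using seq_suble[OF r(1), of i] by linarith
      then have "h2_norm T M (\<lambda>x. S m x - S (r i) x) < e"
        using N \<open>m \<ge> N\<close> by blast
      then show "(\<integral>\<^sup>+x. ennreal ((norm (S m x - S (r i) x))\<^sup>2) \<partial>dt_P T M) \<le> ennreal (e\<^sup>2)"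
        by (subst nn[OF h2_diff[OF S S]]) (auto intro!: ennreal_leI power_mono)
    qed
    finally show ?thesis
      by (simp add: Liminf_const)
  qed
  have diff: "(\<lambda>x. S m x - u x) \<in> h2 T M W"
    if "e > 0" "\<And>i j. i \<ge> N \<Longrightarrow> j \<ge> N \<Longrightarrow> h2_norm T M (\<lambda>x. S i x - S j x) < e" "m \<ge> N" for e N m
  proof -
    have "integrable (dt_P T M) (\<lambda>x. (norm (S m x - u x))\<^sup>2)"
      using Fatou[OF that] by (intro integrableI_nonneg) (auto simp: order_le_less_trans)
    then show ?thesis
      using h2_predictable[OF S] u_pred by (simp add: h2_def)
  qed
  have u: "u \<in> h2 T M W"
  proof -
    obtain N where "\<And>i j. i \<ge> N \<Longrightarrow> j \<ge> N \<Longrightarrow> h2_norm T M (\<lambda>x. S i x - S j x) < 1"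
      using Cauchy[of 1] by auto
    \<comment> \<open>As \<open>u\<close> is \<open>S N - (S N - u)\<close>, it inherits
      square-integrability from the difference.\<close>
    from diff[OF _ this, of N] have "(\<lambda>x. S N x - u x) \<in> h2 T M W" by simp
    from h2_diff[OF S[of N] this] show ?thesis by simp
  qed
  have "(\<lambda>n. h2_norm T M (\<lambda>x. S n x - u x)) \<longlonglongrightarrow> 0"
  proof (rule LIMSEQ_I)
    fix e :: real assume "e > 0"
    then obtain N where N: "\<And>i j. i \<ge> N \<Longrightarrow> j \<ge> N \<Longrightarrow> h2_norm T M (\<lambda>x. S i x - S j x) < e / 2"
      using Cauchy[of "e / 2"] by auto
    have "norm (h2_norm T M (\<lambda>x. S m x - u x) - 0) < e" if "m \<ge> N" for m
    proof -
      have "ennreal ((h2_norm T M (\<lambda>x. S m x - u x))\<^sup>2) \<le> ennreal ((e / 2)\<^sup>2)"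
        unfolding nn[OF h2_diff[OF S u], symmetric]
        by (rule Fatou[of _ N]) (use \<open>e > 0\<close> N that in auto)
      then have "(h2_norm T M (\<lambda>x. S m x - u x))\<^sup>2 \<le> (e / 2)\<^sup>2"
        by (simp add: ennreal_le_iff)
      then have "h2_norm T M (\<lambda>x. S m x - u x) \<le> e / 2"
        using \<open>e > 0\<close> by (auto intro: power2_le_imp_le)
      then show ?thesis using \<open>e > 0\<close> by simp
    qed
    then show "\<exists>N. \<forall>n\<ge>N. norm (h2_norm T M (\<lambda>x. S n x - u x) - 0) < e" by blast
  qed
  with u show ?thesis by blast
qed

section \<open>Orthogonal series\<close>

lemma h2_norm_sum_orthogonal:
  assumes "finite I" and "\<And>i. i \<in> I \<Longrightarrow> g i \<in> h2 T M W"
    and "\<And>i j. i \<in> I \<Longrightarrow> j \<in> I \<Longrightarrow> i \<noteq> j \<Longrightarrow> h2_inner T M (g i) (g j) = 0"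
  shows "(h2_norm T M (\<lambda>x. \<Sum>i\<in>I. g i x))\<^sup>2 = (\<Sum>i\<in>I. (h2_norm T M (g i))\<^sup>2)"
proof -
  have "(h2_norm T M (\<lambda>x. \<Sum>i\<in>I. g i x))\<^sup>2 = (\<Sum>i\<in>I. h2_inner T M (g i) (\<lambda>x. \<Sum>i\<in>I. g i x))"
    using assms by (simp add: h2_norm_power2 h2_inner_sum_left h2_sum)
  also have "\<dots> = (\<Sum>i\<in>I. \<Sum>j\<in>I. h2_inner T M (g j) (g i))"
    using assms by (subst h2_inner_commute) (simp add: h2_inner_sum_left)
  also have "\<dots> = (\<Sum>i\<in>I. \<Sum>j\<in>I. if j = i then (h2_norm T M (g i))\<^sup>2 else 0)"
    using assms by (intro sum.cong) (auto simp: h2_norm_power2)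
  also have "\<dots> = (\<Sum>i\<in>I. (h2_norm T M (g i))\<^sup>2)"
    using assms by simp
  finally show ?thesis .
qed

text \<open>Riesz-Fischer: by Pythagoras the squared distance of two partial sums is a block of the
  numerical series, so the partial sums are Cauchy and completeness applies.\<close>

lemma h2_orthogonal_series:
  fixes g :: "nat \<Rightarrow> real \<times> 'a \<Rightarrow> 'b::euclidean_space"
  assumes g: "\<And>k. g k \<in> h2 T M W"
    and orth: "\<And>k l. k \<noteq> l \<Longrightarrow> h2_inner T M (g k) (g l) = 0"
    and summ: "summable (\<lambda>k. (h2_norm T M (g k))\<^sup>2)"
  shows "\<exists>u\<in>h2 T M W. h2_sums T M g u"
  unfolding h2_sums_def
proof (rule h2_complete)
  let ?S = "\<lambda>n x. \<Sum>k<n. g k x"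
  show "(\<lambda>x. ?S n x) \<in> h2 T M W" for n
    by (intro h2_sum g)
  have diff: "(h2_norm T M (\<lambda>x. ?S n x - ?S m x))\<^sup>2 = (\<Sum>k=m..<n. (h2_norm T M (g k))\<^sup>2)"
    if "m \<le> n" for m n
  proof -
    have "?S n x - ?S m x = (\<Sum>k=m..<n. g k x)" for x
      using sum_diff_nat_ivl[of 0 m n "\<lambda>k. g k x"] that by (simp add: atLeast0LessThan)
    then show ?thesis
      by (simp add: h2_norm_sum_orthogonal[OF _ g orth])
  qed
  fix e :: real assume "e > 0"
  then obtain N where N: "\<And>m n. m \<ge> N \<Longrightarrow> norm (\<Sum>k=m..<n. (h2_norm T M (g k))\<^sup>2) < e\<^sup>2"
    using summ unfolding summable_Cauchy by (meson zero_less_power)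
  have less: "h2_norm T M (\<lambda>x. ?S n x - ?S m x) < e" if "N \<le> m" "m \<le> n" for m n
  proof (rule power2_less_imp_less)
    show "(h2_norm T M (\<lambda>x. ?S n x - ?S m x))\<^sup>2 < e\<^sup>2"
      using N[OF that(1), of n] diff[OF that(2)] by simp
  qed (use \<open>e > 0\<close> in simp)
  show "\<exists>N. \<forall>i\<ge>N. \<forall>j\<ge>N. h2_norm T M (\<lambda>x. ?S i x - ?S j x) < e"
  proof (intro exI allI impI)
    fix i j assume "N \<le> i" "N \<le> j"
    then show "h2_norm T M (\<lambda>x. ?S i x - ?S j x) < e"
      using less[of i j] less[of j i] h2_norm_minus_commute[of "?S i" "?S j"] by fastforce
  qed
qed

text \<open>Expanding the square and Cauchy-Schwarz. It bounds the partial sums of a convergent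
  orthonormal series in \<open>orthonormal_series_iff\<close>.\<close>

lemma h2_norm_le_add_diff:
  assumes "u \<in> h2 T M W" "v \<in> h2 T M W"
  shows "h2_norm T M v \<le> h2_norm T M u + h2_norm T M (\<lambda>x. v x - u x)"
proof -
  have "(h2_norm T M v - h2_norm T M u)\<^sup>2 \<le> (h2_norm T M (\<lambda>x. v x - u x))\<^sup>2"
    using h2_norm_diff_power2[OF assms(2,1)] h2_Cauchy_Schwarz[OF assms(2,1)]
    by (simp add: power2_diff)
  then have "h2_norm T M v - h2_norm T M u \<le> h2_norm T M (\<lambda>x. v x - u x)"
    by (rule power2_le_imp_le) simp
  then show ?thesis by simp
qed

end

section \<open>Sums, moments and coordinate sequences\<close>

text \<open>Nonnegative terms may be regrouped along the fibres of \<open>h\<close>: Tonelli on the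
  pairs (h x, x). It is used with the degree of a label and with the component of an index
  pair.\<close>

lemma
  fixes f :: "'a \<Rightarrow> real"
  assumes nonneg: "\<And>x. x \<in> A \<Longrightarrow> 0 \<le> f x" and h: "\<And>x. x \<in> A \<Longrightarrow> h x \<in> B"
  shows summable_on_fibres_iff:
      "f summable_on A \<longleftrightarrow> (\<forall>b\<in>B. f summable_on {x \<in> A. h x = b}) \<and>
         (\<lambda>b. \<Sum>\<^sub>\<infinity>x\<in>{x \<in> A. h x = b}. f x) summable_on B" (is "_ \<longleftrightarrow> ?R")
    and infsum_fibres:
      "f summable_on A \<Longrightarrow> (\<Sum>\<^sub>\<infinity>b\<in>B. \<Sum>\<^sub>\<infinity>x\<in>{x \<in> A. h x = b}. f x) = infsum f A"
proof -
  let ?\<Sigma> = "Sigma B (\<lambda>b. {x \<in> A. h x = b})"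
  let ?f = "\<lambda>(b, x). f x"
  have bij: "bij_betw snd ?\<Sigma> A"
    using h by (auto simp: bij_betw_def inj_on_def image_iff)
  have abs: "(\<lambda>x. norm (g x)) summable_on C \<longleftrightarrow> g summable_on C" for g :: "'c \<Rightarrow> real" and C
    by (rule summable_on_iff_abs_summable_on_real[symmetric])
  have "f summable_on A \<longleftrightarrow> ?f summable_on ?\<Sigma>"
    using summable_on_reindex_bij_betw[OF bij, of f] by (simp add: case_prod_unfold)
  also have "\<dots> \<longleftrightarrow> (\<forall>b\<in>B. f summable_on {x \<in> A. h x = b}) \<and>
      (\<lambda>b. \<Sum>\<^sub>\<infinity>x\<in>{x \<in> A. h x = b}. norm (f x)) summable_on B"
    using Infinite_Sum.abs_summable_on_Sigma_iff[where f = ?f and A = B and B = "\<lambda>b. {x \<in> A. h x = b}"] by (simp only: abs case_prod_conv)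
  also have "(\<lambda>b. \<Sum>\<^sub>\<infinity>x\<in>{x \<in> A. h x = b}. norm (f x)) = (\<lambda>b. \<Sum>\<^sub>\<infinity>x\<in>{x \<in> A. h x = b}. f x)"
    by (intro ext infsum_cong) (auto simp: nonneg)
  finally show "f summable_on A \<longleftrightarrow> ?R" .
  show "(\<Sum>\<^sub>\<infinity>b\<in>B. \<Sum>\<^sub>\<infinity>x\<in>{x \<in> A. h x = b}. f x) = infsum f A" if "f summable_on A"
  proof -
    have "?f summable_on ?\<Sigma>"
      using that summable_on_reindex_bij_betw[OF bij, of f] by (simp add: case_prod_unfold)
    from infsum_Sigma_banach[OF this] show ?thesis
      using infsum_reindex_bij_betw[OF bij, of f] by (simp add: case_prod_unfold)
  qed
qed

lemma has_sum_sum: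
  fixes f :: "'i \<Rightarrow> 'j \<Rightarrow> real"
  assumes "finite J" and "\<And>j. j \<in> J \<Longrightarrow> ((\<lambda>i. f i j) has_sum g j) I"
  shows "((\<lambda>i. \<Sum>j\<in>J. f i j) has_sum (\<Sum>j\<in>J. g j)) I"
  using assms by (induction J rule: finite_induct) (auto intro: has_sum_add has_sum_0)

lemma summable_on_sum:
  fixes f :: "'i \<Rightarrow> 'j \<Rightarrow> real"
  assumes "finite J" and "\<And>j. j \<in> J \<Longrightarrow> (\<lambda>i. f i j) summable_on I"
  shows "(\<lambda>i. \<Sum>j\<in>J. f i j) summable_on I"
  using has_sum_sum[where f = f and J = J, OF assms(1) has_sum_infsum[OF assms(2)]] by (auto simp: summable_on_def)

text \<open>Markov's inequality for the counting measure.\<close>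

lemma card_superlevel_less:
  fixes f :: "'i \<Rightarrow> real" and r :: nat
  assumes f: "\<And>i. i \<in> I \<Longrightarrow> 0 \<le> f i" and summ: "(\<lambda>i. f i powr p) summable_on I"
    and A: "infsum (\<lambda>i. f i powr p) I \<le> A" "0 < A" and p: "0 < p" and r: "1 \<le> r"
  defines "J \<equiv> {i \<in> I. (A / real r) powr (1 / p) < f i}"
  shows "finite J" and "card J < r"
proof -
  have less: "card F < r" if F: "finite F" "F \<subseteq> J" for F
  proof (cases "F = {}")
    case False
    have "A / real r < f i powr p" if "i \<in> F" for i
    proof -
      have "((A / real r) powr (1 / p)) powr p < f i powr p"
        using that F p by (intro powr_less_mono2) (auto simp: J_def)
      then show ?thesis using p A r by (simp add: powr_powr)
    qed
    then have "(\<Sum>i\<in>F. A / real r) < (\<Sum>i\<in>F. f i powr p)"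
      using F False by (intro sum_strict_mono) auto
    also have "\<dots> \<le> infsum (\<lambda>i. f i powr p) I"
      using F by (intro finite_sum_le_infsum summ) (auto simp: J_def)
    also have "\<dots> \<le> A" by (rule A)
    finally have "real (card F) < real r"
      using A r by (simp add: field_simps)
    then show ?thesis by simp
  qed (use r in simp)
  show fin: "finite J"
  proof (rule ccontr)
    assume "infinite J"
    then obtain F where "finite F" "card F = r" "F \<subseteq> J"
      using infinite_arbitrarily_large by metis
    with less[of F] show False by simp
  qed
  show "card J < r" by (rule less[OF fin]) simp
qed

lemma rearrangement_le:
  assumes "0 \<le> y" "finite {i \<in> I. y < f i}" "card {i \<in> I. y < f i} < r"
  shows "rearrangement f I r \<le> y"
  unfolding rearrangement_def using assms by (intro cInf_lower bdd_belowI[of _ 0]) auto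

text \<open>Each of the summands is at most the largest one, whose power occurs on the right. No
  convexity is involved, so p < 1 and p > 1 are treated alike.\<close>

lemma sum_powr_le:
  fixes b :: "'j::finite \<Rightarrow> real"
  assumes b: "\<And>j. 0 \<le> b j" and p: "0 < p"
  shows "(\<Sum>j\<in>UNIV. b j) powr p \<le> real CARD('j) powr p * (\<Sum>j\<in>UNIV. b j powr p)"
proof -
  have "Max (range b) \<in> range b" by (rule Max_in) auto
  then obtain j where "Max (range b) = b j" by (rule rangeE)
  then have j: "b i \<le> b j" for i by (metis Max_ge finite_class.finite finite_imageI rangeI)
  have "(\<Sum>j\<in>UNIV. b j) powr p \<le> (real CARD('j) * b j) powr p"
    using b p j sum_bounded_above[of UNIV b "b j"] by (intro powr_mono2 sum_nonneg) auto
  also have "\<dots> = real CARD('j) powr p * b j powr p"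
    by (rule powr_mult)
  also have "\<dots> \<le> real CARD('j) powr p * (\<Sum>j\<in>UNIV. b j powr p)"
    by (intro mult_left_mono member_le_sum) auto
  finally show ?thesis .
qed

section \<open>Almost sure summability of random sequences\<close>

lemma pred_summable [measurable (raw)]:
  fixes f :: "nat \<Rightarrow> 'x \<Rightarrow> real"
  assumes [measurable]: "\<And>k. f k \<in> borel_measurable N"
  shows "Measurable.pred N (\<lambda>x. summable (\<lambda>k. f k x))"
  \<comment> \<open>By completeness the limit disappears: being Cauchy is a condition on countably
    many measurable quantities.\<close>
  unfolding summable_iff_convergent Cauchy_convergent_iff[symmetric] by measurable

text \<open>Monotone convergence bounds the integral of the whole sum by C times the sum of
  \<open>g\<close>, and a nonnegative function with finite integral is finite almost
  everywhere.\<close>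

lemma AE_summable_mult:
  fixes g :: "nat \<Rightarrow> real" and Y :: "nat \<Rightarrow> 'w \<Rightarrow> real"
  assumes g: "\<And>k. 0 \<le> g k" "summable g" and Y: "\<And>k w. 0 \<le> Y k w"
    and [measurable]: "\<And>k. Y k \<in> borel_measurable N"
    and bound: "\<And>k. (\<integral>\<^sup>+ w. ennreal (Y k w) \<partial>N) \<le> ennreal C"
  shows "AE w in N. summable (\<lambda>k. g k * Y k w)"
proof -
  have "(\<integral>\<^sup>+ w. (\<Sum>k. ennreal (g k * Y k w)) \<partial>N) = (\<Sum>k. ennreal (g k) * (\<integral>\<^sup>+ w. ennreal (Y k w) \<partial>N))"
    using g Y by (simp add: nn_integral_suminf ennreal_mult nn_integral_cmult)
  also have "\<dots> \<le> (\<Sum>k. ennreal (g k) * ennreal C)"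
    by (intro suminf_le mult_left_mono bound) auto
  also have "\<dots> = ennreal (\<Sum>k. g k) * ennreal C"
    using g by (simp add: suminf_ennreal2)
  also have "\<dots> < \<infinity>"
    by (simp add: ennreal_mult_less_top)
  finally have "AE w in N. (\<Sum>k. ennreal (g k * Y k w)) \<noteq> \<infinity>"
    by (intro nn_integral_PInf_AE) auto
  then show ?thesis
    by eventually_elim (use g Y in \<open>auto intro!: summable_suminf_not_top\<close>)
qed

lemma (in prob_space) nn_integral_square_eq_one:
  assumes "expectation X = 0" "variance X = 1"
  shows "(\<integral>\<^sup>+ w. ennreal ((X w)\<^sup>2) \<partial>M) = 1"
proof -
  have "expectation (\<lambda>w. (X w)\<^sup>2) = 1" using assms by simp
  \<comment> \<open>A non-integrable function has Bochner integral 0, so the value 1 forces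
    integrability.\<close>
  moreover from this have "integrable M (\<lambda>w. (X w)\<^sup>2)"
    using not_integrable_integral_eq[of M "\<lambda>w. (X w)\<^sup>2"] by auto
  ultimately show ?thesis by (simp add: nn_integral_eq_integral)
qed

lemma (in prob_space) nn_integral_powr_le_two:
  assumes [measurable]: "X \<in> borel_measurable M" and X: "expectation X = 0" "variance X = 1"
    and p: "0 < p" "p \<le> 2"
  shows "(\<integral>\<^sup>+ w. ennreal (\<bar>X w\<bar> powr p) \<partial>M) \<le> 2"
proof -
  have "\<bar>x\<bar> powr p \<le> 1 + x\<^sup>2" for x :: real
  proof (cases "\<bar>x\<bar> \<le> 1")
    case True
    then have "\<bar>x\<bar> powr p \<le> 1" using p by (intro powr_le1) auto
    then show ?thesis using zero_le_power2[of x] by linarith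
  next
    case False
    then have "\<bar>x\<bar> powr p \<le> \<bar>x\<bar> powr 2" using p by (intro powr_mono) auto
    with False show ?thesis by simp
  qed
  then have "(\<integral>\<^sup>+ w. ennreal (\<bar>X w\<bar> powr p) \<partial>M) \<le> (\<integral>\<^sup>+ w. 1 + ennreal ((X w)\<^sup>2) \<partial>M)"
    by (intro nn_integral_mono) (simp flip: ennreal_1 ennreal_plus add: ennreal_le_iff)
  also have "\<dots> = 2"
    using nn_integral_square_eq_one[OF X] by (simp add: nn_integral_add emeasure_space_1)
  finally show ?thesis .
qed

lemma bounded_matrix_onD:
  assumes "bounded_matrix_on E nrm A" "a \<in> E"
  shows "(\<lambda>m. \<Sum>n. A m n * a n) \<in> E"
  using assms by (simp add: bounded_matrix_on_def)

text \<open>Centres of the balls that generate the topology. Coding them by lists over a countable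
  type makes the family of balls countable automatically.\<close>

definition rational_sequence :: "rat list \<Rightarrow> nat \<Rightarrow> real" where
  "rational_sequence xs k = (if k < length xs then of_rat (xs ! k) else 0)"

text \<open>The parallelogram law for a - c and b - c with one square dropped. It replaces the
  triangle inequality; c is a ball centre or 0.\<close>

lemma weighted_square_diff_le:
  fixes a b c w :: real
  assumes "0 \<le> w"
  shows "w * (a - b)\<^sup>2 \<le> 2 * (w * (a - c)\<^sup>2) + 2 * (w * (b - c)\<^sup>2)"
proof -
  have "(a - b)\<^sup>2 \<le> 2 * (a - c)\<^sup>2 + 2 * (b - c)\<^sup>2"
    using zero_le_power2[of "(a - c) + (b - c)"] by (simp add: power2_eq_square algebra_simps)
  then have "w * (a - b)\<^sup>2 \<le> w * (2 * (a - c)\<^sup>2 + 2 * (b - c)\<^sup>2)"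
    using assms by (rule mult_left_mono)
  then show ?thesis by (simp add: algebra_simps)
qed

lemma summable_weighted_square_diff:
  fixes a b w :: "nat \<Rightarrow> real"
  assumes "\<And>k. 0 \<le> w k" "summable (\<lambda>k. w k * (a k)\<^sup>2)" "summable (\<lambda>k. w k * (b k)\<^sup>2)"
  shows "summable (\<lambda>k. w k * (a k - b k)\<^sup>2)"
proof (rule summable_comparison_test')
  show "summable (\<lambda>k. 2 * (w k * (a k)\<^sup>2) + 2 * (w k * (b k)\<^sup>2))"
    by (intro summable_add summable_mult assms)
  show "norm (w k * (a k - b k)\<^sup>2) \<le> 2 * (w k * (a k)\<^sup>2) + 2 * (w k * (b k)\<^sup>2)" for k
    using weighted_square_diff_le[OF assms(1), of k "a k" "b k" 0] assms(1)[of k] by simp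
qed

lemma summable_rational_sequence:
  fixes w :: "nat \<Rightarrow> real"
  shows "summable (\<lambda>k. w k * (rational_sequence xs k)\<^sup>2)"
  by (rule summable_finite[of "{..<length xs}"]) (auto simp: rational_sequence_def)

text \<open>Beyond an index n whose tail is below r/2 the approximation is zero; the first n entries
  share the other r/2.\<close>

lemma rational_sequence_dense:
  fixes a w :: "nat \<Rightarrow> real"
  assumes w: "\<And>k. 0 < w k" and a: "summable (\<lambda>k. w k * (a k)\<^sup>2)" and "r > 0"
  shows "\<exists>xs. (\<Sum>k. w k * (a k - rational_sequence xs k)\<^sup>2) < r"
proof -
  obtain n where n: "norm (\<Sum>k. w (k + n) * (a (k + n))\<^sup>2) < r / 2"
    using suminf_exist_split[OF _ a, of "r / 2"] \<open>r > 0\<close> by auto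
  \<comment> \<open>One weighted entry then contributes at most r / (2 (n + 1)).
    \<open>Suc n\<close> keeps the divisor positive for n = 0; strictness of the total comes from
    the tail.\<close>
  define \<delta> where "\<delta> k = sqrt (r / (2 * real (Suc n) * w k))" for k
  have "\<exists>q. \<bar>a k - of_rat q\<bar> < \<delta> k" for k
  proof -
    have "\<delta> k > 0"
      using w[of k] \<open>r > 0\<close> by (simp add: \<delta>_def)
    then obtain q where "a k - \<delta> k < of_rat q" "of_rat q < a k + \<delta> k"
      using of_rat_dense[of "a k - \<delta> k" "a k + \<delta> k"] by auto
    then show ?thesis by (intro exI[of _ q]) (simp add: abs_less_iff)
  qed
  then obtain q where q: "\<bar>a k - of_rat (q k)\<bar> < \<delta> k" for k by metis
  let ?xs = "map q [0..<n]"
  let ?f = "\<lambda>k. w k * (a k - rational_sequence ?xs k)\<^sup>2"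
  have f: "summable ?f"
    by (intro summable_weighted_square_diff a summable_rational_sequence less_imp_le w)
  have "?f k \<le> r / (2 * real (Suc n))" if "k < n" for k
  proof -
    have "(a k - of_rat (q k))\<^sup>2 \<le> (\<delta> k)\<^sup>2"
      using q[of k] by (intro abs_le_square_iff[THEN iffD1]) simp
    also have "\<dots> = r / (2 * real (Suc n) * w k)"
      using w[of k] \<open>r > 0\<close> by (simp add: \<delta>_def del: of_nat_Suc)
    finally have "w k * (a k - of_rat (q k))\<^sup>2 \<le> w k * (r / (2 * real (Suc n) * w k))"
      using w[of k] by (intro mult_left_mono) auto
    then show ?thesis
      using that w[of k] by (simp add: rational_sequence_def del: of_nat_Suc)
  qed
  then have "sum ?f {..<n} \<le> real (card {..<n}) * (r / (2 * real (Suc n)))"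
    by (intro sum_bounded_above) auto
  also have "\<dots> \<le> r / 2"
    using \<open>r > 0\<close> by (simp add: field_simps)
  finally have "sum ?f {..<n} \<le> r / 2" .
  moreover have "(\<Sum>k. ?f (k + n)) = (\<Sum>k. w (k + n) * (a (k + n))\<^sup>2)"
    by (simp add: rational_sequence_def)
  ultimately show ?thesis
    using n suminf_split_initial_segment[OF f, of n] by (intro exI[of _ ?xs]) auto
qed

text \<open>Countably many weighted balls with rational centres and radii generate the topology; the
  centres are sequences that need not be coordinates of elements of \<open>X\<close>.\<close>

lemma sets_norm_borel_coordinates:
  fixes X :: "('c \<Rightarrow> 'b::real_vector) set" and c :: "('c \<Rightarrow> 'b) \<Rightarrow> nat \<Rightarrow> real"
  assumes w: "\<And>k. 1 \<le> w k"
    and summ: "\<And>u. u \<in> X \<Longrightarrow> summable (\<lambda>k. w k * (c u k)\<^sup>2)"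
    and nrm: "\<And>u v. u \<in> X \<Longrightarrow> v \<in> X \<Longrightarrow>
      nrm (\<lambda>x. v x - u x) = sqrt (\<Sum>k. w k * (c v k - c u k)\<^sup>2)"
  shows "sets (norm_borel X nrm) = sets (vimage_algebra X c (\<Pi>\<^sub>M k\<in>UNIV. borel))"
proof
  let ?\<O> = "{G. G \<subseteq> X \<and> (\<forall>u\<in>G. \<exists>e>0. \<forall>v\<in>X. nrm (\<lambda>x. v x - u x) < e \<longrightarrow> v \<in> G)}"
  let ?A = "vimage_algebra X c (\<Pi>\<^sub>M k\<in>UNIV. borel)"
  have w0: "0 < w k" "0 \<le> w k" for k
    using w[of k] by simp_all
  have sets_eq: "sets (norm_borel X nrm) = sigma_sets X ?\<O>" and space_eq: "space (norm_borel X nrm) = X"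
    unfolding norm_borel_def by (subst sets_measure_of space_measure_of; blast)+
  have c_A [measurable]: "(\<lambda>u. c u k) \<in> borel_measurable ?A" for k
    using measurable_compose[OF measurable_vimage_algebra1 measurable_component_singleton, of c X UNIV "\<lambda>_. borel" k]
    by (auto simp: space_PiM)
  show "sets (norm_borel X nrm) \<subseteq> sets ?A"
  proof -
    have "G \<in> sets ?A" if G: "G \<in> ?\<O>" for G
    proof -
      define B where "B = (\<lambda>(xs, r :: rat). {u \<in> X. (\<Sum>k. w k * (c u k - rational_sequence xs k)\<^sup>2) < of_rat r})"
      define S where "S = {s. B s \<subseteq> G}"
      have "\<exists>s\<in>S. u \<in> B s" if u: "u \<in> G" for u
      proof -
        have uX: "u \<in> X" using G u by auto
        obtain e where e: "e > 0" "\<And>v. v \<in> X \<Longrightarrow> nrm (\<lambda>x. v x - u x) < e \<Longrightarrow> v \<in> G"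
          using G u by blast
        \<comment> \<open>Two points of a ball of squared radius r are, by the parallelogram bound,
          at squared distance below 2 r + 2 r < e^2.\<close>
        obtain r :: rat where r: "0 < real_of_rat r" "of_rat r < e\<^sup>2 / 4"
          using of_rat_dense[of 0 "e\<^sup>2 / 4"] e(1) by auto
        obtain xs where xs: "(\<Sum>k. w k * (c u k - rational_sequence xs k)\<^sup>2) < of_rat r"
          using rational_sequence_dense[OF w0(1) summ[OF uX] r(1)] by blast
        have summ_q: "summable (\<lambda>k. w k * (c v k - rational_sequence xs k)\<^sup>2)" if "v \<in> X" for v
          by (intro summable_weighted_square_diff summ that summable_rational_sequence w0)
        have "B (xs, r) \<subseteq> G"
        proof
          fix v assume v: "v \<in> B (xs, r)"
          then have vX: "v \<in> X" by (simp add: B_def)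
          have "(\<Sum>k. w k * (c v k - c u k)\<^sup>2) \<le>
              (\<Sum>k. 2 * (w k * (c v k - rational_sequence xs k)\<^sup>2) + 2 * (w k * (c u k - rational_sequence xs k)\<^sup>2))"
            by (intro suminf_le weighted_square_diff_le w0 summable_add summable_mult summ_q uX vX
                summable_weighted_square_diff summ)
          also have "\<dots> = 2 * (\<Sum>k. w k * (c v k - rational_sequence xs k)\<^sup>2)
              + 2 * (\<Sum>k. w k * (c u k - rational_sequence xs k)\<^sup>2)"
            using summ_q[OF uX] summ_q[OF vX] by (simp add: suminf_add[symmetric] suminf_mult summable_mult)
          also have "\<dots> < e\<^sup>2"
            using xs r v by (simp add: B_def)
          finally have "nrm (\<lambda>x. v x - u x) < sqrt (e\<^sup>2)"
            unfolding nrm[OF uX vX] by (rule real_sqrt_less_mono)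
          with e vX show "v \<in> G" by simp
        qed
        with xs uX show ?thesis
          by (intro bexI[of _ "(xs, r)"]) (auto simp: S_def B_def)
      qed
      then have "G = (\<Union>s\<in>S. B s)"
        by (auto simp: S_def)
      moreover have "B s \<in> sets ?A" for s
      proof -
        have "{u \<in> space ?A. (\<Sum>k. w k * (c u k - rational_sequence xs k)\<^sup>2) < of_rat r} \<in> sets ?A"
          for xs and r :: rat
          by measurable
        then show ?thesis by (cases s) (simp add: B_def)
      qed
      ultimately show ?thesis
        by (auto intro!: sets.countable_UN' countable_subset[OF subset_UNIV])
    qed
    then show ?thesis
      unfolding sets_eq using sets.sigma_sets_subset[of ?\<O> ?A] by auto
  qed
  \<comment> \<open>Weights of at least 1 make each coordinate 1-Lipschitz for \<open>nrm\<close>,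
    so preimages of open sets are among the generators.\<close>
  have "{u \<in> X. c u k \<in> S} \<in> ?\<O>" if "open S" for S k
  proof (intro CollectI conjI ballI)
    fix u assume "u \<in> {u \<in> X. c u k \<in> S}"
    then have u: "u \<in> X" "c u k \<in> S" by auto
    then obtain e where e: "e > 0" "\<And>y. dist y (c u k) < e \<Longrightarrow> y \<in> S"
      using \<open>open S\<close> by (metis open_dist)
    have "v \<in> {u \<in> X. c u k \<in> S}" if v: "v \<in> X" "nrm (\<lambda>x. v x - u x) < e" for v
    proof -
      have "(c v k - c u k)\<^sup>2 \<le> w k * (c v k - c u k)\<^sup>2"
        using mult_right_mono[OF w[of k], of "(c v k - c u k)\<^sup>2"] by simp
      also have "\<dots> = (\<Sum>i\<in>{k}. w i * (c v i - c u i)\<^sup>2)" by simp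
      also have "\<dots> \<le> (\<Sum>i. w i * (c v i - c u i)\<^sup>2)"
        by (intro sum_le_suminf summable_weighted_square_diff summ u v w0) (auto simp: w0)
      finally have "sqrt ((c v k - c u k)\<^sup>2) \<le> nrm (\<lambda>x. v x - u x)"
        unfolding nrm[OF u(1) v(1)] by (rule real_sqrt_le_mono)
      then show ?thesis
        using e v by (auto simp: dist_real_def)
    qed
    then show "\<exists>e>0. \<forall>v\<in>X. nrm (\<lambda>x. v x - u x) < e \<longrightarrow> v \<in> {u \<in> X. c u k \<in> S}"
      using e(1) by blast
  qed auto
  then have "(\<lambda>u. c u k) \<in> borel_measurable (norm_borel X nrm)" for k
    by (intro borel_measurableI) (auto simp: space_eq sets_eq vimage_def Int_def conj_commute)
  then have c: "c \<in> norm_borel X nrm \<rightarrow>\<^sub>M (\<Pi>\<^sub>M k\<in>UNIV. borel)"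
    by (intro measurable_PiM_single') auto
  show "sets ?A \<subseteq> sets (norm_borel X nrm)"
  proof -
    have "{c -` S \<inter> X | S. S \<in> sets (\<Pi>\<^sub>M k\<in>UNIV. borel)} \<subseteq> sets (norm_borel X nrm)"
      using measurable_sets[OF c] by (auto simp: space_eq)
    from sets.sigma_sets_subset[OF this] show ?thesis
      by (simp add: sets_vimage_algebra space_eq)
  qed
qed

section \<open>Chaoslet expansions\<close>

text \<open>Countability of the labels lets projections be built as sequential series. In the
  theorem it follows from the enumeration of the vector-valued basis.\<close>

locale chaos_onb = h2_space T M W
  for T :: real and M :: "'a measure" and W :: "real \<Rightarrow> 'a \<Rightarrow> real ^ 'n" +
  fixes V :: "(real \<times> 'a \<Rightarrow> real) set"
  assumes V_closed_subspace: "h2_closed_subspace T M W V"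
    and chaoslet_onb: "h2_onb T M W V (chaoslet T W) chaos_labels"
    and countable_labels: "countable (chaos_labels :: 'n chaos_label set)"
begin

abbreviation e :: "'n chaos_label \<Rightarrow> real \<times> 'a \<Rightarrow> real" where
  "e \<equiv> chaoslet T W"

abbreviation coef :: "(real \<times> 'a \<Rightarrow> real) \<Rightarrow> 'n chaos_label \<Rightarrow> real" where
  "coef u l \<equiv> h2_inner T M u (e l)"

lemma V_h2: "u \<in> V \<Longrightarrow> u \<in> h2 T M W"
  using V_closed_subspace by (auto simp: h2_closed_subspace_def)

lemma V_zero: "(\<lambda>_. 0) \<in> V"
  using V_closed_subspace by (simp add: h2_closed_subspace_def)

lemma V_lincomb: "u \<in> V \<Longrightarrow> v \<in> V \<Longrightarrow> (\<lambda>x. a * u x + b * v x) \<in> V"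
  using V_closed_subspace by (simp add: h2_closed_subspace_def)

lemma V_add: "u \<in> V \<Longrightarrow> v \<in> V \<Longrightarrow> (\<lambda>x. u x + v x) \<in> V"
  using V_lincomb[of u v 1 1] by simp

lemma V_diff: "u \<in> V \<Longrightarrow> v \<in> V \<Longrightarrow> (\<lambda>x. u x - v x) \<in> V"
  using V_lincomb[of u v 1 "-1"] by simp

lemma V_scale: "u \<in> V \<Longrightarrow> (\<lambda>x. a * u x) \<in> V"
  using V_lincomb[of u u a 0] by simp

lemma V_sum: "(\<And>i. i \<in> I \<Longrightarrow> f i \<in> V) \<Longrightarrow> (\<lambda>x. \<Sum>i\<in>I. f i x) \<in> V"
  by (induction I rule: infinite_finite_induct) (auto intro: V_zero V_add)

lemma V_limit:
  assumes "u \<in> h2 T M W" and "\<And>n. S n \<in> V" and "(\<lambda>n. h2_norm T M (\<lambda>x. u x - S n x)) \<longlonglongrightarrow> 0"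
  shows "u \<in> V"
proof -
  have "\<exists>v\<in>V. h2_norm T M (\<lambda>x. u x - v x) < r" if "r > 0" for r
    using LIMSEQ_D[OF assms(3) that] assms(2) by auto
  then show ?thesis
    using V_closed_subspace assms(1) by (auto simp: h2_closed_subspace_def)
qed

lemma e_V: "l \<in> chaos_labels \<Longrightarrow> e l \<in> V"
  using chaoslet_onb by (simp add: h2_onb_def)

lemma e_h2: "l \<in> chaos_labels \<Longrightarrow> e l \<in> h2 T M W"
  by (intro V_h2 e_V)

lemma coef_e: "l \<in> chaos_labels \<Longrightarrow> l' \<in> chaos_labels \<Longrightarrow> coef (e l) l' = (if l = l' then 1 else 0)"
  using chaoslet_onb by (simp add: h2_onb_def)

lemma coef_diff:
  "u \<in> h2 T M W \<Longrightarrow> v \<in> h2 T M W \<Longrightarrow> l \<in> chaos_labels \<Longrightarrow> coef (\<lambda>x. u x - v x) l = coef u l - coef v l"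
  by (simp add: h2_inner_diff_left e_h2)

lemma scale_h2: "u \<in> h2 T M W \<Longrightarrow> (\<lambda>x. a * u x) \<in> h2 T M W" for u :: "real \<times> 'a \<Rightarrow> real"
  using h2_scaleR[of u a] by simp

lemma combination_h2: "F \<subseteq> chaos_labels \<Longrightarrow> (\<lambda>x. \<Sum>l\<in>F. c l * e l x) \<in> h2 T M W"
  by (intro h2_sum scale_h2 e_h2) auto

lemma inner_combination:
  assumes "F \<subseteq> chaos_labels" and "v \<in> h2 T M W"
  shows "h2_inner T M (\<lambda>x. \<Sum>l\<in>F. c l * e l x) v = (\<Sum>l\<in>F. c l * coef v l)"
proof -
  have "h2_inner T M (\<lambda>x. c l * e l x) v = c l * coef v l" for l
    using h2_inner_scaleR_left[of "c l" "e l" v] by (simp add: h2_inner_commute)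
  then show ?thesis
    using assms by (subst h2_inner_sum_left) (auto intro!: scale_h2 e_h2)
qed

text \<open>Completing the square: the last sum vanishes for Fourier coefficients and is nonnegative
  otherwise. Bessel, Parseval and the error of a truncated expansion are all read off from
  it.\<close>

lemma norm_diff_combination:
  assumes F: "finite F" "F \<subseteq> chaos_labels" and u: "u \<in> h2 T M W"
  shows "(h2_norm T M (\<lambda>x. u x - (\<Sum>l\<in>F. c l * e l x)))\<^sup>2
    = (h2_norm T M u)\<^sup>2 - (\<Sum>l\<in>F. (coef u l)\<^sup>2) + (\<Sum>l\<in>F. (c l - coef u l)\<^sup>2)"
proof -
  let ?v = "\<lambda>x. \<Sum>l\<in>F. c l * e l x"
  note v = combination_h2[OF F(2), of c]
  have uv: "h2_inner T M u ?v = (\<Sum>l\<in>F. c l * coef u l)"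
    by (subst h2_inner_commute) (rule inner_combination[OF F(2) u])
  have "coef ?v l = c l" if "l \<in> F" for l
  proof -
    have "coef ?v l = (\<Sum>k\<in>F. c k * coef (e l) k)"
      using F that by (intro inner_combination e_h2) auto
    also have "\<dots> = (\<Sum>k\<in>F. if k = l then c l else 0)"
      using F that by (intro sum.cong) (auto simp: coef_e subset_iff)
    finally show ?thesis using F that by simp
  qed
  then have "(h2_norm T M ?v)\<^sup>2 = (\<Sum>l\<in>F. (c l)\<^sup>2)"
    using inner_combination[OF F(2) v, of c] by (simp add: h2_norm_power2) (simp add: power2_eq_square)
  then show ?thesis
    by (subst h2_norm_diff_power2[OF u v])
       (simp add: uv power2_diff sum.distrib sum_subtractf sum_distrib_left mult_ac)
qed

section \<open>Parseval identities and orthogonal projections\<close>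

lemma bessel:
  assumes "finite F" "F \<subseteq> chaos_labels" "u \<in> h2 T M W"
  shows "(\<Sum>l\<in>F. (coef u l)\<^sup>2) \<le> (h2_norm T M u)\<^sup>2"
  using norm_diff_combination[OF assms, of "coef u"]
    zero_le_power2[of "h2_norm T M (\<lambda>x. u x - (\<Sum>l\<in>F. coef u l * e l x))"] by simp

lemma summable_on_coef:
  assumes "J \<subseteq> chaos_labels" "u \<in> h2 T M W"
  shows "(\<lambda>l. (coef u l)\<^sup>2) summable_on J"
  using bessel[OF _ _ assms(2)] assms(1)
  by (intro nonneg_bdd_above_summable_on bdd_aboveI[of _ "(h2_norm T M u)\<^sup>2"]) auto

text \<open>Bessel gives one inequality. For the other, a combination over F that is close to u can
  only be improved by taking Fourier coefficients over F.\<close>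

lemma parseval_closed_span:
  assumes J: "J \<subseteq> chaos_labels" and u: "u \<in> h2_closed_span T M W e J"
  shows "((\<lambda>l. (coef u l)\<^sup>2) has_sum (h2_norm T M u)\<^sup>2) J"
proof -
  have u_h2: "u \<in> h2 T M W" using u by (simp add: h2_closed_span_def)
  note summ = summable_on_coef[OF J u_h2]
  have "infsum (\<lambda>l. (coef u l)\<^sup>2) J \<le> (h2_norm T M u)\<^sup>2"
    using J u_h2 by (intro infsum_le_finite_sums summ bessel) auto
  moreover have "(h2_norm T M u)\<^sup>2 \<le> infsum (\<lambda>l. (coef u l)\<^sup>2) J"
  proof (rule field_le_epsilon)
    fix r :: real assume "r > 0"
    then obtain F c where F: "finite F" "F \<subseteq> J"
      and less: "h2_norm T M (\<lambda>x. u x - (\<Sum>l\<in>F. c l * e l x)) < sqrt r"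
      using u by (auto simp: h2_closed_span_def dest!: spec[of _ "sqrt r"])
    have "(h2_norm T M (\<lambda>x. u x - (\<Sum>l\<in>F. c l * e l x)))\<^sup>2 < (sqrt r)\<^sup>2"
      using less by (intro power_strict_mono) auto
    then have "(h2_norm T M u)\<^sup>2 - (\<Sum>l\<in>F. (coef u l)\<^sup>2) < r"
      using norm_diff_combination[OF F(1) _ u_h2, of c] F(2) J \<open>r > 0\<close>
        sum_nonneg[of F "\<lambda>l. (c l - coef u l)\<^sup>2"] by auto
    moreover have "(\<Sum>l\<in>F. (coef u l)\<^sup>2) \<le> infsum (\<lambda>l. (coef u l)\<^sup>2) J"
      using F by (intro finite_sum_le_infsum summ) auto
    ultimately show "(h2_norm T M u)\<^sup>2 \<le> infsum (\<lambda>l. (coef u l)\<^sup>2) J + r" by linarith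
  qed
  ultimately show ?thesis
    using has_sum_infsum[OF summ] by simp
qed

lemma parseval: "u \<in> V \<Longrightarrow> ((\<lambda>l. (coef u l)\<^sup>2) has_sum (h2_norm T M u)\<^sup>2) chaos_labels"
  using chaoslet_onb by (intro parseval_closed_span) (auto simp: h2_onb_def)

text \<open>Y is the sum of the Fourier series of X over J, which converges by Bessel and
  Riesz-Fischer.\<close>

lemma projection_exists:
  assumes J: "J \<subseteq> chaos_labels" and X: "X \<in> h2 T M W"
  obtains Y where "Y \<in> h2_closed_span T M W e J"
    and "\<And>l. l \<in> J \<Longrightarrow> coef Y l = coef X l"
proof -
  let ?L = "chaos_labels :: 'n chaos_label set"
  let ?\<kappa> = "from_nat_into ?L"
  \<comment> \<open>\<open>K\<close> keeps exactly the canonical code of each label in J, so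
    \<open>?\<kappa>\<close> visits each such label once; all other terms of the series are
    zero.\<close>
  define K where "K = {k. ?\<kappa> k \<in> J \<and> to_nat_on ?L (?\<kappa> k) = k}"
  have \<kappa>: "?\<kappa> (to_nat_on ?L l) = l" "to_nat_on ?L l \<in> K" if "l \<in> J" for l
    using that J countable_labels by (auto simp: K_def)
  have inj: "inj_on ?\<kappa> K"
    by (rule inj_onI) (metis (mono_tags, lifting) K_def mem_Collect_eq)
  have KJ: "?\<kappa> k \<in> J" if "k \<in> K" for k
    using that by (simp add: K_def)
  define g where "g k x = (if k \<in> K then coef X (?\<kappa> k) * e (?\<kappa> k) x else 0)" for k x
  have g_eq: "g k = (if k \<in> K then (\<lambda>x. coef X (?\<kappa> k) * e (?\<kappa> k) x) else (\<lambda>_. 0))" for k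
    by (auto simp: g_def)
  have g_h2: "g k \<in> h2 T M W" for k
    using KJ J by (auto simp: g_eq intro!: scale_h2 e_h2 h2_zero)
  have inner_g: "h2_inner T M (g k) v = (if k \<in> K then coef X (?\<kappa> k) * coef v (?\<kappa> k) else 0)" for k v
    using h2_inner_scaleR_left[of "coef X (?\<kappa> k)" "e (?\<kappa> k)" v] by (simp add: g_eq h2_inner_commute)
  have coef_g: "coef (g k) l = (if k \<in> K \<and> ?\<kappa> k = l then coef X l else 0)" if "l \<in> J" for k l
    using that KJ J by (auto simp: inner_g coef_e subset_iff)
  have orth: "h2_inner T M (g k) (g l) = 0" if "k \<noteq> l" for k l
  proof (cases "k \<in> K")
    case True
    then show ?thesis
      using that inj KJ by (auto simp: inner_g[of k] coef_g inj_on_eq_iff)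
  qed (simp add: inner_g)
  have norm_g: "(h2_norm T M (g k))\<^sup>2 = (if k \<in> K then (coef X (?\<kappa> k))\<^sup>2 else 0)" for k
    unfolding h2_norm_power2 using KJ J by (auto simp: inner_g coef_e power2_eq_square subset_iff)
  have partial: "(\<Sum>k<n. if k \<in> K then f (?\<kappa> k) else 0) = (\<Sum>l\<in>?\<kappa> ` (K \<inter> {..<n}). f l)"
    for n and f :: "_ \<Rightarrow> real"
    using inj by (subst sum.reindex) (auto intro: inj_on_subset simp: sum.If_cases Int_commute Collect_conj_eq)
  have "summable (\<lambda>k. (h2_norm T M (g k))\<^sup>2)"
  proof (rule summableI_nonneg_bounded)
    show "(\<Sum>k<n. (h2_norm T M (g k))\<^sup>2) \<le> (h2_norm T M X)\<^sup>2" for n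
      unfolding norm_g partial[of "\<lambda>l. (coef X l)\<^sup>2"]
      using KJ J X by (intro bessel) auto
  qed simp
  from h2_orthogonal_series[OF g_h2 orth this]
  obtain Y where Y: "Y \<in> h2 T M W" "h2_sums T M g Y" by auto
  have S_eq: "(\<Sum>k<n. g k x) = (\<Sum>l\<in>?\<kappa> ` (K \<inter> {..<n}). coef X l * e l x)" for n x
    using partial[of "\<lambda>l. coef X l * e l x"] by (simp add: g_def)
  have "Y \<in> h2_closed_span T M W e J"
    unfolding h2_closed_span_def
  proof (intro CollectI conjI allI impI Y)
    fix r :: real assume "r > 0"
    then obtain n where "h2_norm T M (\<lambda>x. (\<Sum>k<n. g k x) - Y x) < r"
      using LIMSEQ_D[OF Y(2)[unfolded h2_sums_def]] by fastforce
    then have "h2_norm T M (\<lambda>x. Y x - (\<Sum>l\<in>?\<kappa> ` (K \<inter> {..<n}). coef X l * e l x)) < r"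
      by (subst h2_norm_minus_commute) (simp add: S_eq)
    moreover have "?\<kappa> ` (K \<inter> {..<n}) \<subseteq> J" using KJ by auto
    ultimately show "\<exists>F c. finite F \<and> F \<subseteq> J \<and> h2_norm T M (\<lambda>x. Y x - (\<Sum>l\<in>F. c l * e l x)) < r"
      by (intro exI[of _ "?\<kappa> ` (K \<inter> {..<n})"] exI[of _ "coef X"]) auto
  qed
  moreover have "coef Y l = coef X l" if l: "l \<in> J" for l
  \<comment> \<open>The coefficient of the partial sums converges to that of Y by continuity, and is
    constantly that of X once the code of l has been passed.\<close>
  proof (rule LIMSEQ_unique)
    show "(\<lambda>n. coef (\<lambda>x. \<Sum>k<n. g k x) l) \<longlonglongrightarrow> coef Y l"
      using Y l J by (intro h2_inner_tendsto h2_sum g_h2 e_h2) (auto simp: h2_sums_def)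
    have "coef (\<lambda>x. \<Sum>k<n. g k x) l = coef X l" if "to_nat_on ?L l < n" for n
    proof -
      have "coef (\<lambda>x. \<Sum>k<n. g k x) l = (\<Sum>k<n. coef (g k) l)"
        using l J by (intro h2_inner_sum_left g_h2 e_h2) auto
      also have "\<dots> = (\<Sum>k<n. if k = to_nat_on ?L l then coef X l else 0)"
        using l \<kappa>[OF l] by (intro sum.cong) (auto simp: coef_g K_def)
      finally show ?thesis using that by simp
    qed
    then have "\<forall>\<^sub>F n in sequentially. coef (\<lambda>x. \<Sum>k<n. g k x) l = coef X l"
      by (intro eventually_sequentiallyI[of "Suc (to_nat_on ?L l)"]) simp
    then show "(\<lambda>n. coef (\<lambda>x. \<Sum>k<n. g k x) l) \<longlonglongrightarrow> coef X l"
      by (rule tendsto_eventually)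
  qed
  ultimately show ?thesis using that by blast
qed

text \<open>u is orthogonal to all finite combinations. Approximating Z by one of them to within
  |<u,Z>| / |u| would contradict Cauchy-Schwarz if <u,Z> were nonzero.\<close>

lemma orthogonal_closed_span:
  assumes J: "J \<subseteq> chaos_labels" and u: "u \<in> h2 T M W" and "\<And>l. l \<in> J \<Longrightarrow> coef u l = 0"
    and Z: "Z \<in> h2_closed_span T M W e J"
  shows "h2_inner T M u Z = 0"
proof (rule ccontr)
  assume nz: "h2_inner T M u Z \<noteq> 0"
  have Z_h2: "Z \<in> h2 T M W" using Z by (simp add: h2_closed_span_def)
  have pos: "h2_norm T M u > 0"
    using h2_Cauchy_Schwarz[OF u Z_h2] nz h2_norm_nonneg[of u] by (cases "h2_norm T M u = 0") (auto simp: order_less_le)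
  then have "\<bar>h2_inner T M u Z\<bar> / h2_norm T M u > 0" using nz by simp
  with Z obtain F c where F: "finite F" "F \<subseteq> J"
    and less: "h2_norm T M (\<lambda>x. Z x - (\<Sum>l\<in>F. c l * e l x)) < \<bar>h2_inner T M u Z\<bar> / h2_norm T M u"
    unfolding h2_closed_span_def by blast
  let ?v = "\<lambda>x. \<Sum>l\<in>F. c l * e l x"
  have v: "?v \<in> h2 T M W" using F J by (intro combination_h2) auto
  have "h2_inner T M ?v u = 0"
    using F J assms(3) u by (subst inner_combination) (auto intro!: sum.neutral)
  then have "h2_inner T M u Z = h2_inner T M (\<lambda>x. Z x - ?v x) u"
    using h2_inner_diff_left[OF Z_h2 v u] by (simp add: h2_inner_commute[of u Z])
  also have "\<bar>\<dots>\<bar> \<le> h2_norm T M (\<lambda>x. Z x - ?v x) * h2_norm T M u"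
    by (intro h2_Cauchy_Schwarz h2_diff Z_h2 v u)
  also have "\<dots> < \<bar>h2_inner T M u Z\<bar>"
    using less pos by (simp add: field_simps)
  finally show False by simp
qed

text \<open>\<open>h2_proj\<close> chooses some representative, so existence comes before any
  statement about it. Whichever is chosen has the coefficients of X in degree n, and Parseval in the
  closed span gives its norm.\<close>

lemma has_sum_chaos_proj:
  assumes X: "X \<in> h2 T M W"
  shows "((\<lambda>l. (coef X l)\<^sup>2) has_sum (h2_norm T M (chaos_proj T M W n X))\<^sup>2)
    {l \<in> chaos_labels. chaos_degree l = n}"
proof -
  let ?J = "{l \<in> chaos_labels. chaos_degree l = n}"
  let ?K = "h2_closed_span T M W e ?J"
  define Y where "Y = chaos_proj T M W n X"
  obtain Y' where Y': "Y' \<in> ?K" "\<And>l. l \<in> ?J \<Longrightarrow> coef Y' l = coef X l"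
    using projection_exists[OF _ X, of ?J] by auto
  have Y'_h2: "Y' \<in> h2 T M W" using Y'(1) by (simp add: h2_closed_span_def)
  have "h2_inner T M (\<lambda>x. X x - Y' x) Z = 0" if "Z \<in> ?K" for Z
    by (rule orthogonal_closed_span[OF _ h2_diff[OF X Y'_h2] _ that])
       (auto simp: coef_diff X Y'_h2 Y'(2))
  with Y'(1) have "\<exists>Y. Y \<in> ?K \<and> (\<forall>Z\<in>?K. h2_inner T M (\<lambda>x. X x - Y x) Z = 0)" by blast
  from someI_ex[OF this]
  have Y: "Y \<in> ?K" "\<And>Z. Z \<in> ?K \<Longrightarrow> h2_inner T M (\<lambda>x. X x - Y x) Z = 0"
    by (simp_all add: Y_def chaos_proj_def h2_proj_def)
  have Y_h2: "Y \<in> h2 T M W" using Y(1) by (simp add: h2_closed_span_def)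
  have "coef Y l = coef X l" if l: "l \<in> ?J" for l
  proof -
    have "e l \<in> ?K"
      unfolding h2_closed_span_def
    proof (intro CollectI conjI allI impI)
      show "e l \<in> h2 T M W" using l by (auto intro: e_h2)
      fix r :: real assume "r > 0"
      then show "\<exists>F c. finite F \<and> F \<subseteq> ?J \<and> h2_norm T M (\<lambda>x. e l x - (\<Sum>l\<in>F. c l * e l x)) < r"
        using l by (intro exI[of _ "{l}"] exI[of _ "\<lambda>_. 1"]) (auto simp: h2_norm_def)
    qed
    from Y(2)[OF this] show ?thesis
      using X Y_h2 l by (simp add: coef_diff)
  qed
  then have "((\<lambda>l. (coef X l)\<^sup>2) has_sum (h2_norm T M Y)\<^sup>2) ?J \<longleftrightarrow>
      ((\<lambda>l. (coef Y l)\<^sup>2) has_sum (h2_norm T M Y)\<^sup>2) ?J"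
    by (intro has_sum_cong) auto
  then show ?thesis
    using parseval_closed_span[OF _ Y(1)] by (auto simp: Y_def)
qed

text \<open>The weight is constant on the labels of a fixed degree, so the n-th term of the Sobolev
  series is the sum of \<open>f\<close> over a fibre of the degree.\<close>

lemma
  fixes s :: nat
  assumes X: "X \<in> V"
  defines "f \<equiv> \<lambda>l. (1 + real (chaos_degree l)) ^ s * (coef X l)\<^sup>2"
  shows sobolev_iff: "X \<in> sobolev T M W V s \<longleftrightarrow> f summable_on chaos_labels"
    and sobolev_suminf: "f summable_on chaos_labels \<Longrightarrow>
      (\<Sum>n. (1 + real n) ^ s * (h2_norm T M (chaos_proj T M W n X))\<^sup>2) = infsum f chaos_labels"
proof -
  let ?J = "\<lambda>n. {l \<in> chaos_labels. chaos_degree l = n}"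
  define g where "g = (\<lambda>n. (1 + real n) ^ s * (h2_norm T M (chaos_proj T M W n X))\<^sup>2)"
  have f_nonneg: "0 \<le> f l" for l by (simp add: f_def)
  have hs: "(f has_sum g n) (?J n)" for n
  proof -
    have "((\<lambda>l. (1 + real n) ^ s * (coef X l)\<^sup>2) has_sum g n) (?J n)"
      unfolding g_def by (intro has_sum_cmult_right has_sum_chaos_proj V_h2 X)
    then show ?thesis
      by (rule has_sum_cong[THEN iffD1, rotated]) (auto simp: f_def)
  qed
  have inf: "infsum f (?J n) = g n" for n
    using hs by (rule infsumI)
  have "X \<in> sobolev T M W V s \<longleftrightarrow> g summable_on UNIV"
    using X by (subst summable_on_UNIV_nonneg_real_iff) (auto simp: sobolev_def g_def)
  also have "\<dots> \<longleftrightarrow> f summable_on chaos_labels"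
    using summable_on_fibres_iff[of chaos_labels f chaos_degree UNIV] hs
    by (auto simp: f_nonneg inf summable_on_def)
  finally show "X \<in> sobolev T M W V s \<longleftrightarrow> f summable_on chaos_labels" .
  assume f: "f summable_on chaos_labels"
  then have "g summable_on UNIV"
    using summable_on_fibres_iff[of chaos_labels f chaos_degree UNIV]
    by (auto simp: f_nonneg inf)
  then have "(g has_sum infsum g UNIV) UNIV"
    by (rule has_sum_infsum)
  then have "suminf g = infsum g UNIV"
    by (intro sums_unique[symmetric] has_sum_imp_sums)
  also have "\<dots> = infsum f chaos_labels"
    using infsum_fibres[OF _ _ f, of chaos_degree UNIV] by (simp add: f_nonneg inf)
  finally show "(\<Sum>n. (1 + real n) ^ s * (h2_norm T M (chaos_proj T M W n X))\<^sup>2) = infsum f chaos_labels"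
    by (simp add: g_def)
qed

end

section \<open>Vector-valued processes\<close>

locale vec_chaos_onb = chaos_onb T M W V
  for T :: real and M :: "'a measure" and W :: "real \<Rightarrow> 'a \<Rightarrow> real ^ 'n"
    and V :: "(real \<times> 'a \<Rightarrow> real) set" +
  fixes enum :: "nat \<Rightarrow> 'n chaos_label \<times> 'd::finite"
  assumes bij_enum: "bij_betw enum UNIV (chaos_labels \<times> UNIV)"
begin

abbreviation \<phi> :: "nat \<Rightarrow> real \<times> 'a \<Rightarrow> real ^ 'd" where
  "\<phi> k \<equiv> vec_chaoslet T W (enum k)"

abbreviation H :: "(real \<times> 'a \<Rightarrow> real ^ 'd) set" where
  "H \<equiv> vec_space V"

definition coord :: "(real \<times> 'a \<Rightarrow> real ^ 'd) \<Rightarrow> nat \<Rightarrow> real" where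
  "coord u k = h2_inner T M u (\<phi> k)"

lemma coord_eq: "coord u k = coef (\<lambda>x. u x $ snd (enum k)) (fst (enum k))"
  by (simp add: coord_def vec_chaoslet_def h2_inner_def inner_axis case_prod_unfold mult.commute)

lemma enum_in: "fst (enum k) \<in> chaos_labels"
  using bij_betwE[OF bij_enum] by (auto simp: mem_Times_iff)

lemma h2_component: "u \<in> h2 T M W \<Longrightarrow> (\<lambda>x. u x $ j) \<in> h2 T M W" for u :: "real \<times> 'a \<Rightarrow> real ^ 'd"
  using vec_space_h2[OF brownian, where 'd = 'd] by (auto simp: vec_space_def)

lemma H_h2: "u \<in> H \<Longrightarrow> u \<in> h2 T M W"
  using vec_space_h2[OF brownian, where 'd = 'd] V_h2 by (auto simp: vec_space_def)

lemma h2_norm_components: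
  fixes u :: "real \<times> 'a \<Rightarrow> real ^ 'd"
  assumes "u \<in> h2 T M W"
  shows "(h2_norm T M u)\<^sup>2 = (\<Sum>j\<in>UNIV. (h2_norm T M (\<lambda>x. u x $ j))\<^sup>2)"
  using h2_integrable_inner[OF h2_component[OF assms] h2_component[OF assms]]
  by (simp add: h2_norm_power2) (simp add: h2_inner_def inner_vec_def)

lemma H_diff: "u \<in> H \<Longrightarrow> v \<in> H \<Longrightarrow> (\<lambda>x. u x - v x) \<in> H"
  by (simp add: vec_space_def V_diff)

lemma H_scaleR: "u \<in> H \<Longrightarrow> (\<lambda>x. a *\<^sub>R u x) \<in> H"
  by (simp add: vec_space_def V_scale)

lemma H_sum: "(\<And>i. i \<in> I \<Longrightarrow> f i \<in> H) \<Longrightarrow> (\<lambda>x. \<Sum>i\<in>I. f i x) \<in> H"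
  by (simp add: vec_space_def V_sum)

lemma H_zero: "(\<lambda>_. 0) \<in> H"
  by (simp add: vec_space_def V_zero)

lemma H_chaoslet: "l \<in> chaos_labels \<Longrightarrow> (\<lambda>x. chaoslet T W l x *\<^sub>R b) \<in> H"
  using V_scale[OF e_V] by (simp add: vec_space_def mult.commute)

lemma \<phi>_H: "\<phi> k \<in> H"
  using H_chaoslet[OF enum_in[of k]] by (simp add: vec_chaoslet_def case_prod_unfold)

lemma coord_diff: "u \<in> H \<Longrightarrow> v \<in> H \<Longrightarrow> coord (\<lambda>x. u x - v x) k = coord u k - coord v k"
  unfolding coord_def by (intro h2_inner_diff_left H_h2 \<phi>_H)

lemma coord_\<phi>: "coord (\<phi> m) k = (if m = k then 1 else 0)"
proof -
  have "coord (\<phi> m) k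
      = coef (\<lambda>x. (axis (snd (enum m)) 1 $ snd (enum k)) *\<^sub>R e (fst (enum m)) x) (fst (enum k))"
    unfolding coord_eq by (simp add: vec_chaoslet_def case_prod_unfold mult.commute)
  also have "\<dots> = (axis (snd (enum m)) 1 $ snd (enum k)) * coef (e (fst (enum m))) (fst (enum k))"
    by (rule h2_inner_scaleR_left)
  also have "\<dots> = (if enum m = enum k then 1 else 0)"
    by (simp add: coef_e enum_in axis_def prod_eq_iff)
  finally show ?thesis
    using bij_betw_imp_inj_on[OF bij_enum] by (simp add: inj_eq)
qed

text \<open>Passage between the single index of the vector-valued basis and one sum per component;
  nonnegativity makes the order of summation irrelevant.\<close>

lemma
  fixes g :: "'n chaos_label \<times> 'd \<Rightarrow> real"
  assumes nonneg: "\<And>z. 0 \<le> g z"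
  shows summable_enum_iff: "summable (\<lambda>k. g (enum k)) \<longleftrightarrow> (\<forall>j. (\<lambda>l. g (l, j)) summable_on chaos_labels)"
    and suminf_enum: "summable (\<lambda>k. g (enum k)) \<Longrightarrow>
      (\<Sum>k. g (enum k)) = (\<Sum>j\<in>UNIV. \<Sum>\<^sub>\<infinity>l\<in>chaos_labels. g (l, j))"
proof -
  let ?A = "(chaos_labels :: 'n chaos_label set) \<times> (UNIV :: 'd set)"
  have fibre: "bij_betw (\<lambda>l. (l, j)) chaos_labels {z \<in> ?A. snd z = j}" for j
    by (auto simp: bij_betw_def inj_on_def)
  have 1: "summable (\<lambda>k. g (enum k)) \<longleftrightarrow> g summable_on ?A"
    using summable_on_UNIV_nonneg_real_iff[of "\<lambda>k. g (enum k)"]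
      summable_on_reindex_bij_betw[OF bij_enum, of g] nonneg by simp
  have 2: "g summable_on {z \<in> ?A. snd z = j} \<longleftrightarrow> (\<lambda>l. g (l, j)) summable_on chaos_labels" for j
    using summable_on_reindex_bij_betw[OF fibre, of g j] by simp
  show "summable (\<lambda>k. g (enum k)) \<longleftrightarrow> (\<forall>j. (\<lambda>l. g (l, j)) summable_on chaos_labels)"
    unfolding 1 using summable_on_fibres_iff[of ?A g snd UNIV] by (simp add: nonneg 2)
  assume "summable (\<lambda>k. g (enum k))"
  then have A: "g summable_on ?A" by (simp add: 1)
  then have "((\<lambda>k. g (enum k)) has_sum infsum g ?A) UNIV"
    by (subst has_sum_reindex_bij_betw[OF bij_enum, of g]) (rule has_sum_infsum)
  then have "(\<Sum>k. g (enum k)) = infsum g ?A"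
    by (intro sums_unique[symmetric] has_sum_imp_sums)
  also have "\<dots> = (\<Sum>j\<in>UNIV. \<Sum>\<^sub>\<infinity>z\<in>{z \<in> ?A. snd z = j}. g z)"
    using infsum_fibres[OF _ _ A, of snd UNIV] by (simp add: nonneg)
  also have "\<dots> = (\<Sum>j\<in>UNIV. \<Sum>\<^sub>\<infinity>l\<in>chaos_labels. g (l, j))"
    using infsum_reindex_bij_betw[OF fibre, of g] by simp
  finally show "(\<Sum>k. g (enum k)) = (\<Sum>j\<in>UNIV. \<Sum>\<^sub>\<infinity>l\<in>chaos_labels. g (l, j))" .
qed

lemma
  assumes u: "u \<in> H"
  shows summable_coord: "summable (\<lambda>k. (coord u k)\<^sup>2)"
    and parseval_coord: "(h2_norm T M u)\<^sup>2 = (\<Sum>k. (coord u k)\<^sup>2)"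
proof -
  have comp: "(\<lambda>x. u x $ j) \<in> V" for j using u by (simp add: vec_space_def)
  let ?g = "\<lambda>z. (coef (\<lambda>x. u x $ snd z) (fst z))\<^sup>2"
  have eq: "(\<lambda>k. (coord u k)\<^sup>2) = (\<lambda>k. ?g (enum k))" by (simp add: coord_eq)
  show summ: "summable (\<lambda>k. (coord u k)\<^sup>2)"
    unfolding eq using parseval[OF comp] by (subst summable_enum_iff) (auto simp: summable_on_def)
  show "(h2_norm T M u)\<^sup>2 = (\<Sum>k. (coord u k)\<^sup>2)"
    using suminf_enum[of ?g] summ infsumI[OF parseval[OF comp]]
    by (simp add: eq h2_norm_components H_h2 u)
qed

lemma
  fixes s :: nat
  defines "w \<equiv> \<lambda>k. (1 + real (chaos_degree (fst (enum k)))) ^ s"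
  shows vec_sobolev_iff:
      "u \<in> vec_space (sobolev T M W V s) \<longleftrightarrow> u \<in> H \<and> summable (\<lambda>k. w k * (coord u k)\<^sup>2)"
    and sobolev_norm_coord: "u \<in> vec_space (sobolev T M W V s) \<Longrightarrow>
      sobolev_norm T M W s u = sqrt (\<Sum>k. w k * (coord u k)\<^sup>2)"
proof -
  let ?g = "\<lambda>z. (1 + real (chaos_degree (fst z))) ^ s * (coef (\<lambda>x. u x $ snd z) (fst z))\<^sup>2"
  have eq: "(\<lambda>k. w k * (coord u k)\<^sup>2) = (\<lambda>k. ?g (enum k))" by (simp add: coord_eq w_def)
  have sub: "sobolev T M W V s \<subseteq> V" by (auto simp: sobolev_def)
  show iff: "u \<in> vec_space (sobolev T M W V s) \<longleftrightarrow> u \<in> H \<and> summable (\<lambda>k. w k * (coord u k)\<^sup>2)"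
  proof (cases "u \<in> H")
    case True
    then have comp: "(\<lambda>x. u x $ j) \<in> V" for j by (simp add: vec_space_def)
    show ?thesis
      unfolding eq using True
      by (subst summable_enum_iff) (auto simp: vec_space_def sobolev_iff[OF comp])
  qed (use sub in \<open>auto simp: vec_space_def\<close>)
  assume u: "u \<in> vec_space (sobolev T M W V s)"
  then have comp: "(\<lambda>x. u x $ j) \<in> V" for j using sub by (auto simp: vec_space_def)
  have "(\<Sum>n. (1 + real n) ^ s * (h2_norm T M (chaos_proj T M W n (\<lambda>x. u x $ j)))\<^sup>2)
      = (\<Sum>\<^sub>\<infinity>l\<in>chaos_labels. ?g (l, j))" for j
    using u sobolev_suminf[OF comp, where s = s] sobolev_iff[OF comp, where s = s] by (simp add: vec_space_def)
  then show "sobolev_norm T M W s u = sqrt (\<Sum>k. w k * (coord u k)\<^sup>2)"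
    using u iff suminf_enum[of ?g] by (simp add: sobolev_norm_def eq)
qed

section \<open>Distances and Borel sets in coordinates\<close>

lemma h2_norm_diff_coord:
  assumes "u \<in> H" "v \<in> H"
  shows "h2_norm T M (\<lambda>x. v x - u x) = sqrt (\<Sum>k. (coord v k - coord u k)\<^sup>2)"
proof -
  have "(h2_norm T M (\<lambda>x. v x - u x))\<^sup>2 = (\<Sum>k. (coord v k - coord u k)\<^sup>2)"
    using parseval_coord[OF H_diff[OF assms(2,1)]] by (simp add: coord_diff assms)
  then show ?thesis by (intro real_sqrt_unique[symmetric]) auto
qed

lemma sobolev_norm_diff_coord:
  fixes s :: nat
  defines "w \<equiv> \<lambda>k. (1 + real (chaos_degree (fst (enum k)))) ^ s"
  assumes u: "u \<in> vec_space (sobolev T M W V s)" and v: "v \<in> vec_space (sobolev T M W V s)"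
  shows "sobolev_norm T M W s (\<lambda>x. v x - u x) = sqrt (\<Sum>k. w k * (coord v k - coord u k)\<^sup>2)"
proof -
  note iff = vec_sobolev_iff[of _ s, folded w_def]
  have "(\<lambda>x. v x - u x) \<in> vec_space (sobolev T M W V s)"
    using u v unfolding iff
    by (auto simp: coord_diff H_diff w_def intro!: summable_weighted_square_diff)
  from sobolev_norm_coord[OF this] show ?thesis
    using u v by (simp add: iff coord_diff w_def)
qed

text \<open>Weight 1 here, weight (1 + deg)^s in \<open>sets_sobolev_borel\<close>: the two
  topologies lead to the same description by coordinates.\<close>

lemma sets_h2_borel: "sets (h2_borel T M H) = sets (vimage_algebra H coord (\<Pi>\<^sub>M k\<in>UNIV. borel))"
  unfolding h2_borel_def
  by (rule sets_norm_borel_coordinates[where w = "\<lambda>_. 1"])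
     (simp_all add: summable_coord h2_norm_diff_coord)

lemma space_h2_borel: "space (h2_borel T M H) = H"
  unfolding h2_borel_def norm_borel_def by (subst space_measure_of) auto

lemma sets_sobolev_borel:
  fixes s :: nat
  defines "D \<equiv> vec_space (sobolev T M W V s) :: (real \<times> 'a \<Rightarrow> real ^ 'd) set"
  shows "sets (norm_borel D (sobolev_norm T M W s)) = sets (vimage_algebra D coord (\<Pi>\<^sub>M k\<in>UNIV. borel))"
  unfolding D_def
  by (rule sets_norm_borel_coordinates[where w = "\<lambda>k. (1 + real (chaos_degree (fst (enum k)))) ^ s"])
     (simp_all add: vec_sobolev_iff sobolev_norm_diff_coord)

lemma measurable_coord [measurable]: "(\<lambda>u. coord u k) \<in> borel_measurable (h2_borel T M H)"
proof -
  have "(\<lambda>u. coord u k) \<in> borel_measurable (vimage_algebra H coord (\<Pi>\<^sub>M k\<in>UNIV. borel))"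
    using measurable_compose[OF measurable_vimage_algebra1 measurable_component_singleton,
        of coord H UNIV "\<lambda>_. borel" k] by (auto simp: space_PiM)
  then show ?thesis by (simp cong: measurable_cong_sets add: sets_h2_borel)
qed

text \<open>Reduces measurability of an \<open>H\<close>-valued map to real functions, so that the
  choice of representatives does not matter.\<close>

lemma measurable_h2_borelI:
  assumes "\<And>w. w \<in> space N \<Longrightarrow> f w \<in> H" and "\<And>k. (\<lambda>w. coord (f w) k) \<in> borel_measurable N"
  shows "f \<in> N \<rightarrow>\<^sub>M h2_borel T M H"
proof -
  have "(\<lambda>w. coord (f w)) \<in> N \<rightarrow>\<^sub>M (\<Pi>\<^sub>M k\<in>UNIV. borel)"
    using assms(2) by (intro measurable_PiM_single') auto
  then have "f \<in> N \<rightarrow>\<^sub>M vimage_algebra H coord (\<Pi>\<^sub>M k\<in>UNIV. borel)"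
    using assms(1) by (intro measurable_vimage_algebra2) auto
  then show ?thesis by (simp cong: measurable_cong_sets add: sets_h2_borel)
qed

section \<open>Coefficient decay and best approximation\<close>

lemma norm_chaos_coeff_power2:
  "(norm (chaos_coeff T M W u l))\<^sup>2 = (\<Sum>j\<in>UNIV. (coef (\<lambda>x. u x $ j) l)\<^sup>2)" for u :: "real \<times> 'a \<Rightarrow> real ^ 'd"
  by (simp add: chaos_coeff_def norm_vec_def L2_set_def sum_nonneg)

text \<open>Compressibility groups the scalar coordinates of a label into one vector. Its Euclidean
  norm is at most the sum of its entries' absolute values, and the power of that sum costs a factor
  depending on the dimension and p.\<close>

lemma summable_chaos_coeff_powr:
  assumes p: "0 < p" and summ: "summable (\<lambda>k. \<bar>coord u k\<bar> powr p)"
  shows "(\<lambda>l. norm (chaos_coeff T M W u l) powr p) summable_on chaos_labels"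
proof -
  let ?b = "\<lambda>l j. \<bar>coef (\<lambda>x. u x $ j) l\<bar>"
  have "(\<lambda>l. ?b l j powr p) summable_on chaos_labels" for j
    using summ summable_enum_iff[of "\<lambda>z. ?b (fst z) (snd z) powr p"] by (simp add: coord_eq)
  then have "(\<lambda>l. real CARD('d) powr p * (\<Sum>j\<in>UNIV. ?b l j powr p)) summable_on chaos_labels"
    by (intro summable_on_cmult_right summable_on_sum) auto
  then show ?thesis
  proof (rule summable_on_comparison_test)
    fix l assume "l \<in> (chaos_labels :: 'n chaos_label set)"
    have "norm (chaos_coeff T M W u l) powr p \<le> (\<Sum>j\<in>UNIV. ?b l j) powr p"
      using p norm_le_l1_cart[of "chaos_coeff T M W u l"] by (intro powr_mono2) (auto simp: chaos_coeff_def)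
    also have "\<dots> \<le> real CARD('d) powr p * (\<Sum>j\<in>UNIV. ?b l j powr p)"
      by (rule sum_powr_le) (use p in auto)
    finally show "norm (chaos_coeff T M W u l) powr p \<le> real CARD('d) powr p * (\<Sum>j\<in>UNIV. ?b l j powr p)" .
  qed auto
qed

text \<open>Per component, the truncation error is the full Parseval sum minus the part over
  F.\<close>

lemma norm_diff_chaos_sum:
  assumes u: "u \<in> H" and F: "finite F" "F \<subseteq> chaos_labels"
  shows "((\<lambda>l. (norm (chaos_coeff T M W u l))\<^sup>2) has_sum
    (h2_norm T M (\<lambda>x. u x - (\<Sum>l\<in>F. chaoslet T W l x *\<^sub>R chaos_coeff T M W u l)))\<^sup>2) (chaos_labels - F)"
proof -
  let ?r = "\<lambda>x. u x - (\<Sum>l\<in>F. chaoslet T W l x *\<^sub>R chaos_coeff T M W u l)"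
  have comp: "(\<lambda>x. u x $ j) \<in> V" for j using u by (simp add: vec_space_def)
  have r_H: "?r \<in> H"
    using F by (intro H_diff u H_sum H_chaoslet) auto
  have norm_r: "(h2_norm T M (\<lambda>x. ?r x $ j))\<^sup>2
      = (h2_norm T M (\<lambda>x. u x $ j))\<^sup>2 - (\<Sum>l\<in>F. (coef (\<lambda>x. u x $ j) l)\<^sup>2)" for j
    using norm_diff_combination[OF F V_h2[OF comp], where c = "coef (\<lambda>x. u x $ j)"]
    by (simp add: chaos_coeff_def mult.commute)
  have "((\<lambda>l. (coef (\<lambda>x. u x $ j) l)\<^sup>2) has_sum (h2_norm T M (\<lambda>x. ?r x $ j))\<^sup>2) (chaos_labels - F)" for j
    unfolding norm_r using F by (intro has_sum_Diff parseval comp has_sum_finite)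
  then show ?thesis
    unfolding norm_chaos_coeff_power2 h2_norm_components[OF H_h2[OF r_H]]
    by (intro has_sum_sum) auto
qed

lemma best_N_term_error_nonneg: "0 \<le> best_N_term_error T M W u N" for u :: "real \<times> 'a \<Rightarrow> real ^ 'd"
  unfolding best_N_term_error_def
proof (rule cInf_greatest)
  show "{h2_norm T M (\<lambda>x. u x - (\<Sum>n<N. chaoslet T W (m n) x *\<^sub>R \<beta> n)) | m \<beta>.
      \<forall>n<N. m n \<in> chaos_labels} \<noteq> {}"
    by (auto simp: chaos_labels_def intro!: exI[of _ "\<lambda>_. Constant"])
qed auto

text \<open>Fewer than N labels are padded to N terms by \<open>Constant\<close> with coefficient 0;
  labels may repeat in an N-term sum.\<close>

lemma best_N_term_error_le:
  fixes u :: "real \<times> 'a \<Rightarrow> real ^ 'd" and \<beta> :: "'n chaos_label \<Rightarrow> real ^ 'd"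
  assumes F: "finite F" "F \<subseteq> chaos_labels" "card F \<le> N"
  shows "best_N_term_error T M W u N \<le> h2_norm T M (\<lambda>x. u x - (\<Sum>l\<in>F. chaoslet T W l x *\<^sub>R \<beta> l))"
proof -
  obtain h where h: "bij_betw h {0..<card F} F"
    using ex_bij_betw_nat_finite[OF F(1)] by blast
  define m where "m n = (if n < card F then h n else Constant)" for n
  define \<gamma> where "\<gamma> n = (if n < card F then \<beta> (h n) else 0)" for n
  have m: "\<forall>n<N. m n \<in> chaos_labels"
    using h F(2) by (auto simp: m_def bij_betw_def chaos_labels_def)
  have "(\<Sum>n<N. chaoslet T W (m n) x *\<^sub>R \<gamma> n) = (\<Sum>l\<in>F. chaoslet T W l x *\<^sub>R \<beta> l)" for x
  proof -
    have "(\<Sum>n<N. chaoslet T W (m n) x *\<^sub>R \<gamma> n) = (\<Sum>n\<in>{0..<card F}. chaoslet T W (h n) x *\<^sub>R \<beta> (h n))"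
      using F(3) by (intro sum.mono_neutral_cong_right) (auto simp: m_def \<gamma>_def)
    also have "\<dots> = (\<Sum>l\<in>F. chaoslet T W l x *\<^sub>R \<beta> l)"
      by (rule sum.reindex_bij_betw[OF h])
    finally show ?thesis .
  qed
  then show ?thesis
    unfolding best_N_term_error_def using m
    by (intro cInf_lower bdd_belowI[of _ 0] CollectI exI[of _ m] exI[of _ \<gamma>]) auto
qed

text \<open>One threshold serves both claims: fewer than r coefficients exceed y r, which bounds the
  rearrangement, and keeping just these is an admissible r-term approximation.\<close>

lemma
  assumes u: "u \<in> H" and p: "0 < p" and summ: "summable (\<lambda>k. \<bar>coord u k\<bar> powr p)"
  shows compressibleI: "compressible T M W (1 / p) u"
    and best_N_term_error_bigo: "p < 2 \<Longrightarrow>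
      best_N_term_error T M W u \<in> O(\<lambda>n. real n powr (- (1 / p - 1 / 2)))"
proof -
  let ?f = "\<lambda>l. norm (chaos_coeff T M W u l)"
  note f = summable_chaos_coeff_powr[OF p summ]
  \<comment> \<open>The added 1 keeps the constant positive for the zero process too, as
    \<open>compressible\<close> demands.\<close>
  define A where "A = infsum (\<lambda>l. ?f l powr p) chaos_labels + 1"
  have "0 \<le> infsum (\<lambda>l. ?f l powr p) chaos_labels" by (intro infsum_nonneg) auto
  then have A: "infsum (\<lambda>l. ?f l powr p) chaos_labels \<le> A" "0 < A" by (simp_all add: A_def)
  define y where "y r = (A / real r) powr (1 / p)" for r
  define J where "J r = {l \<in> chaos_labels. y r < ?f l}" for r
  have J: "finite (J r)" "card (J r) < r" if "1 \<le> r" for r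
    unfolding J_def y_def using card_superlevel_less[OF _ f A p that] by auto
  show "compressible T M W (1 / p) u"
    unfolding compressible_def
  proof (intro exI[of _ "A powr (1 / p)"] conjI allI impI)
    fix r :: nat assume r: "1 \<le> r"
    have "rearrangement ?f chaos_labels r \<le> y r"
      using J[OF r] by (intro rearrangement_le) (auto simp: J_def y_def)
    also have "y r = A powr (1 / p) * real r powr (- (1 / p))"
      using A(2) r by (simp add: y_def powr_divide powr_minus_divide)
    finally show "rearrangement ?f chaos_labels r \<le> A powr (1 / p) * real r powr (- (1 / p))" .
  qed (use A in simp)
  assume p2: "p < 2"
  show "best_N_term_error T M W u \<in> O(\<lambda>n. real n powr (- (1 / p - 1 / 2)))"
  proof (rule bigoI[of _ "A powr (1 / p)"], rule eventually_sequentiallyI[of 1])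
    fix n :: nat assume n: "1 \<le> n"
    let ?r = "\<lambda>x. u x - (\<Sum>l\<in>J n. chaoslet T W l x *\<^sub>R chaos_coeff T M W u l)"
    have JL: "J n \<subseteq> chaos_labels" by (auto simp: J_def)
    have hs: "((\<lambda>l. (?f l)\<^sup>2) has_sum (h2_norm T M ?r)\<^sup>2) (chaos_labels - J n)"
      by (rule norm_diff_chaos_sum[OF u J(1)[OF n] JL])
    have f': "(\<lambda>l. ?f l powr p) summable_on (chaos_labels - J n)"
      by (rule summable_on_subset[OF f]) auto
    have "(h2_norm T M ?r)\<^sup>2 \<le> infsum (\<lambda>l. y n powr (2 - p) * ?f l powr p) (chaos_labels - J n)"
      unfolding infsumI[OF hs, symmetric]
    proof (rule infsum_mono)
      show "(\<lambda>l. (?f l)\<^sup>2) summable_on (chaos_labels - J n)" using hs by (auto simp: summable_on_def)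
      show "(\<lambda>l. y n powr (2 - p) * ?f l powr p) summable_on (chaos_labels - J n)"
        by (intro summable_on_cmult_right f')
      fix l assume "l \<in> chaos_labels - J n"
      then have le: "?f l \<le> y n" by (auto simp: J_def)
      \<comment> \<open>Off \<open>J n\<close> the coefficient is at most the threshold; because 2 -
        p > 0 one factor can absorb this bound while the other remains summable.\<close>
      have "(?f l)\<^sup>2 = ?f l powr (2 - p) * ?f l powr p"
        by (cases "?f l = 0") (simp_all flip: powr_add)
      also have "\<dots> \<le> y n powr (2 - p) * ?f l powr p"
        using le p2 by (intro mult_right_mono powr_mono2) auto
      finally show "(?f l)\<^sup>2 \<le> y n powr (2 - p) * ?f l powr p" .
    qed
    also have "\<dots> = y n powr (2 - p) * infsum (\<lambda>l. ?f l powr p) (chaos_labels - J n)"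
      by (rule infsum_cmult_right) (rule f')
    also have "\<dots> \<le> y n powr (2 - p) * A"
    proof (rule mult_left_mono)
      have "infsum (\<lambda>l. ?f l powr p) (chaos_labels - J n) \<le> infsum (\<lambda>l. ?f l powr p) chaos_labels"
        by (intro infsum_mono_neutral f f') auto
      then show "infsum (\<lambda>l. ?f l powr p) (chaos_labels - J n) \<le> A" using A(1) by linarith
    qed simp
    \<comment> \<open>Since (2 - p) / p = 2/p - 1, the extra factor A lifts its exponent to 2/p, and
      the square of the claimed bound appears.\<close>
    also have "\<dots> = (A powr (1 / p) * real n powr (- (1 / p - 1 / 2)))\<^sup>2"
    proof -
      have "y n powr (2 - p) = A powr (2 / p - 1) / real n powr (2 / p - 1)"
        using A(2) p by (simp add: y_def powr_powr powr_divide field_simps)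
      moreover have "A powr (2 / p - 1) * A = A powr (2 / p)"
        using A(2) powr_add[of A "2 / p - 1" 1] by simp
      moreover have "(A powr (1 / p))\<^sup>2 = A powr (2 / p)"
        using A(2) powr_power[of A "1 / p" 2] by (simp add: mult.commute)
      moreover have "(real n powr (- (1 / p - 1 / 2)))\<^sup>2 = inverse (real n powr (2 / p - 1))"
        using n powr_power[of "real n" "- (1 / p - 1 / 2)" 2]
        by (simp add: algebra_simps flip: powr_minus)
      ultimately show ?thesis
        by (simp add: power_mult_distrib field_simps)
    qed
    finally have "h2_norm T M ?r \<le> A powr (1 / p) * real n powr (- (1 / p - 1 / 2))"
      by (rule power2_le_imp_le) simp
    moreover have "best_N_term_error T M W u n \<le> h2_norm T M ?r"
      using J[OF n] JL by (intro best_N_term_error_le) auto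
    ultimately show "norm (best_N_term_error T M W u n) \<le> A powr (1 / p) * norm (real n powr (- (1 / p - 1 / 2)))"
      using best_N_term_error_nonneg[of u n] by simp
  qed
qed

subsection \<open>Orthonormal series\<close>

text \<open>The sum exists among all square-integrable predictable processes; closedness of V,
  applied to each component, places it in \<open>H\<close>.\<close>

lemma H_orthogonal_series:
  fixes g :: "nat \<Rightarrow> real \<times> 'a \<Rightarrow> real ^ 'd"
  assumes g: "\<And>k. g k \<in> H"
    and orth: "\<And>k l. k \<noteq> l \<Longrightarrow> h2_inner T M (g k) (g l) = 0"
    and summ: "summable (\<lambda>k. (h2_norm T M (g k))\<^sup>2)"
  shows "\<exists>u\<in>H. h2_sums T M g u"
proof -
  obtain u where u: "u \<in> h2 T M W" "h2_sums T M g u"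
    using h2_orthogonal_series[OF H_h2[OF g] orth summ] by blast
  let ?S = "\<lambda>n x. \<Sum>k<n. g k x"
  have S: "?S n \<in> H" for n by (intro H_sum g)
  have "(\<lambda>x. u x $ j) \<in> V" for j
  proof (rule V_limit[where S = "\<lambda>n x. ?S n x $ j"])
    show "(\<lambda>x. u x $ j) \<in> h2 T M W" by (rule h2_component[OF u(1)])
    show "(\<lambda>x. ?S n x $ j) \<in> V" for n using S[of n] by (simp add: vec_space_def)
    show "(\<lambda>n. h2_norm T M (\<lambda>x. u x $ j - ?S n x $ j)) \<longlonglongrightarrow> 0"
    proof (rule Lim_null_comparison[OF always_eventually], rule allI)
      show "norm (h2_norm T M (\<lambda>x. u x $ j - ?S n x $ j)) \<le> h2_norm T M (\<lambda>x. ?S n x - u x)" for n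
      proof -
        let ?d = "\<lambda>x. u x - ?S n x"
        have "(h2_norm T M (\<lambda>x. ?d x $ j))\<^sup>2 \<le> (\<Sum>j\<in>UNIV. (h2_norm T M (\<lambda>x. ?d x $ j))\<^sup>2)"
          by (rule member_le_sum) auto
        also have "\<dots> = (h2_norm T M ?d)\<^sup>2"
          by (rule h2_norm_components[symmetric]) (intro h2_diff u H_h2 S)
        finally have "h2_norm T M (\<lambda>x. ?d x $ j) \<le> h2_norm T M ?d"
          by (rule power2_le_imp_le) simp
        then show ?thesis
          using h2_norm_minus_commute[of u "?S n"] by simp
      qed
      show "(\<lambda>n. h2_norm T M (\<lambda>x. ?S n x - u x)) \<longlonglongrightarrow> 0"
        using u(2) by (simp add: h2_sums_def)
    qed
  qed
  with u(2) show ?thesis by (auto simp: vec_space_def)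
qed

context
  fixes \<psi> :: "nat \<Rightarrow> real \<times> 'a \<Rightarrow> real ^ 'd"
  assumes \<psi>_H: "\<And>k. \<psi> k \<in> H"
    and \<psi>_inner: "\<And>k l. h2_inner T M (\<psi> k) (\<psi> l) = (if k = l then 1 else 0)"
begin

lemma inner_scaled: "h2_inner T M (\<lambda>x. a *\<^sub>R \<psi> k x) (\<lambda>x. b *\<^sub>R \<psi> l x) = (if k = l then a * b else 0)"
  by (simp add: h2_inner_scaleR_left h2_inner_commute[of "\<psi> k"] \<psi>_inner)

text \<open>An equivalence is needed because \<open>h2_suminf\<close> returns 0 on divergence: it
  turns that case distinction into one on numerical summability, a measurable event in the random
  setting.\<close>

lemma orthonormal_series_iff:
  "(\<exists>u\<in>H. h2_sums T M (\<lambda>k x. a k *\<^sub>R \<psi> k x) u) \<longleftrightarrow> summable (\<lambda>k. (a k)\<^sup>2)"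
proof
  let ?S = "\<lambda>n x. \<Sum>k<n. a k *\<^sub>R \<psi> k x"
  assume "\<exists>u\<in>H. h2_sums T M (\<lambda>k x. a k *\<^sub>R \<psi> k x) u"
  then obtain u where u: "u \<in> H" "(\<lambda>n. h2_norm T M (\<lambda>x. ?S n x - u x)) \<longlonglongrightarrow> 0"
    by (auto simp: h2_sums_def)
  have S: "?S n \<in> H" for n by (intro H_sum H_scaleR \<psi>_H)
  from convergent_imp_Bseq[OF convergentI[OF u(2)]]
  obtain B where B: "\<forall>n. norm (h2_norm T M (\<lambda>x. ?S n x - u x)) \<le> B"
    by (rule BseqE)
  have "(\<Sum>k<n. (a k)\<^sup>2) \<le> (h2_norm T M u + B)\<^sup>2" for n
  proof -
    have "(\<Sum>k<n. (a k)\<^sup>2) = (h2_norm T M (?S n))\<^sup>2"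
      by (subst h2_norm_sum_orthogonal)
         (auto simp: inner_scaled h2_norm_power2 H_h2 H_scaleR \<psi>_H simp flip: power2_eq_square)
    also have "\<dots> \<le> (h2_norm T M u + B)\<^sup>2"
      using h2_norm_le_add_diff[OF H_h2[OF u(1)] H_h2[OF S[of n]]] B[rule_format, of n]
      by (intro power_mono) auto
    finally show ?thesis .
  qed
  then show "summable (\<lambda>k. (a k)\<^sup>2)"
    by (intro summableI_nonneg_bounded) auto
next
  assume "summable (\<lambda>k. (a k)\<^sup>2)"
  then show "\<exists>u\<in>H. h2_sums T M (\<lambda>k x. a k *\<^sub>R \<psi> k x) u"
    by (intro H_orthogonal_series)
       (auto simp: inner_scaled h2_norm_power2 H_scaleR \<psi>_H simp flip: power2_eq_square)
qed

lemma coord_orthonormal_series: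
  assumes u: "u \<in> H" "h2_sums T M (\<lambda>k x. a k *\<^sub>R \<psi> k x) u"
  shows "(\<lambda>k. h2_inner T M (\<psi> k) (\<phi> m) * a k) sums coord u m"
proof -
  have "h2_inner T M (\<lambda>x. \<Sum>k<n. a k *\<^sub>R \<psi> k x) (\<phi> m) = (\<Sum>k<n. h2_inner T M (\<psi> k) (\<phi> m) * a k)" for n
    by (subst h2_inner_sum_left)
       (auto intro!: H_h2 H_scaleR \<psi>_H \<phi>_H simp: h2_inner_scaleR_left mult.commute)
  moreover have "(\<lambda>n. h2_inner T M (\<lambda>x. \<Sum>k<n. a k *\<^sub>R \<psi> k x) (\<phi> m)) \<longlonglongrightarrow> h2_inner T M u (\<phi> m)"
    using u(2) by (intro h2_inner_tendsto) (auto intro!: H_h2 H_sum H_scaleR \<psi>_H \<phi>_H u simp: h2_sums_def)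
  ultimately show ?thesis by (simp add: sums_def coord_def)
qed

text \<open>The chosen sum is determined up to null sets, which inner products do not see; the 0 in
  the second branch is the default of \<open>h2_suminf\<close>.\<close>

lemma
  fixes a :: "nat \<Rightarrow> real"
  defines "u \<equiv> h2_suminf T M H (\<lambda>k x. a k *\<^sub>R \<psi> k x)"
  shows h2_suminf_H: "u \<in> H"
    and coord_h2_suminf: "coord u m =
      (if summable (\<lambda>k. (a k)\<^sup>2) then \<Sum>k. h2_inner T M (\<psi> k) (\<phi> m) * a k else 0)"
proof -
  let ?P = "\<lambda>u. u \<in> H \<and> h2_sums T M (\<lambda>k x. a k *\<^sub>R \<psi> k x) u"
  have "u \<in> H \<and> coord u m =
      (if summable (\<lambda>k. (a k)\<^sup>2) then \<Sum>k. h2_inner T M (\<psi> k) (\<phi> m) * a k else 0)"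
  proof (cases "summable (\<lambda>k. (a k)\<^sup>2)")
    case True
    then have "u = (SOME u. ?P u)" and "\<exists>u. ?P u"
      using orthonormal_series_iff[of a] by (auto simp: u_def h2_suminf_def)
    then have "?P u" by (metis (mono_tags, lifting) someI_ex)
    then show ?thesis
      using coord_orthonormal_series[of u a m] True by (simp add: sums_unique)
  next
    case False
    then have "u = (\<lambda>_. 0)"
      using orthonormal_series_iff[of a] by (simp add: u_def h2_suminf_def)
    then show ?thesis
      using False by (simp add: H_zero coord_def)
  qed
  then show "u \<in> H" and "coord u m =
      (if summable (\<lambda>k. (a k)\<^sup>2) then \<Sum>k. h2_inner T M (\<psi> k) (\<phi> m) * a k else 0)"
    by simp_all
qed

end

subsection \<open>Compressible processes in the Sobolev space\<close>

text \<open>Conditions on coordinates alone, hence a measurable event. It implies all the asserted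
  properties, so these pass to the law without a measurability proof for rearrangements or best
  errors.\<close>

definition compressible_sobolev :: "real \<Rightarrow> nat \<Rightarrow> (real \<times> 'a \<Rightarrow> real ^ 'd) set" where
  "compressible_sobolev p s = {u \<in> H. (\<lambda>k. coord u k) \<in> lp_space p \<and>
     (\<lambda>k. coord u k) \<in> weighted_l2 (\<lambda>k. chaos_degree (fst (enum k))) s}"

lemma compressible_sobolevD:
  assumes "0 < p" "u \<in> compressible_sobolev p s"
  shows "compressible T M W (1 / p) u" and "u \<in> vec_space (sobolev T M W V s)"
    and "p < 2 \<Longrightarrow> best_N_term_error T M W u \<in> O(\<lambda>n. real n powr (- (1 / p - 1 / 2)))"
proof -
  have u: "u \<in> H" and lp: "summable (\<lambda>k. \<bar>coord u k\<bar> powr p)"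
    using assms(2) by (auto simp: compressible_sobolev_def lp_space_def)
  show "compressible T M W (1 / p) u" by (rule compressibleI[OF u assms(1) lp])
  show "p < 2 \<Longrightarrow> best_N_term_error T M W u \<in> O(\<lambda>n. real n powr (- (1 / p - 1 / 2)))"
    by (rule best_N_term_error_bigo[OF u assms(1) lp])
  show "u \<in> vec_space (sobolev T M W V s)"
    using assms(2) by (simp add: compressible_sobolev_def weighted_l2_def vec_sobolev_iff)
qed

lemma sets_compressible_sobolev: "compressible_sobolev p s \<in> sets (h2_borel T M H)"
proof -
  have "{u \<in> space (h2_borel T M H). summable (\<lambda>k. \<bar>coord u k\<bar> powr p) \<and>
      summable (\<lambda>k. (1 + real (chaos_degree (fst (enum k)))) ^ s * \<bar>coord u k\<bar>\<^sup>2)} \<in> sets (h2_borel T M H)"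
    by measurable
  then show ?thesis
    by (simp add: space_h2_borel compressible_sobolev_def lp_space_def weighted_l2_def)
qed

lemma sets_vec_sobolev: "vec_space (sobolev T M W V s) \<in> sets (h2_borel T M H)"
proof -
  have "{u \<in> space (h2_borel T M H).
      summable (\<lambda>k. (1 + real (chaos_degree (fst (enum k)))) ^ s * (coord u k)\<^sup>2)} \<in> sets (h2_borel T M H)"
    by measurable
  moreover have "vec_space (sobolev T M W V s) = {u \<in> space (h2_borel T M H).
      summable (\<lambda>k. (1 + real (chaos_degree (fst (enum k)))) ^ s * (coord u k)\<^sup>2)}"
    by (auto simp: vec_sobolev_iff space_h2_borel)
  ultimately show ?thesis by simp
qed

text \<open>Both sides are pullbacks of the product sigma-algebra under \<open>coord\<close>,
  restricted to \<open>D\<close>.\<close>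

lemma sets_restrict_vec_sobolev:
  fixes s :: nat
  defines "D \<equiv> vec_space (sobolev T M W V s) :: (real \<times> 'a \<Rightarrow> real ^ 'd) set"
  shows "sets (restrict_space (h2_borel T M H) D) = sets (norm_borel D (sobolev_norm T M W s))"
proof -
  let ?P = "\<Pi>\<^sub>M k\<in>UNIV. borel :: real measure"
  have D: "D \<subseteq> H" by (auto simp: D_def vec_sobolev_iff)
  have "sets (restrict_space (h2_borel T M H) D) = sets (restrict_space (vimage_algebra H coord ?P) D)"
    by (rule sets_restrict_space_cong[OF sets_h2_borel])
  also have "\<dots> = sets (vimage_algebra D (\<lambda>u. u) (vimage_algebra H coord ?P))"
    using D by (intro restrict_space_eq_vimage_algebra) simp
  also have "\<dots> = sets (vimage_algebra D coord ?P)"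
    using D by (subst vimage_algebra_vimage_algebra_eq) (auto simp: space_PiM)
  also have "\<dots> = sets (norm_borel D (sobolev_norm T M W s))"
    unfolding D_def by (rule sets_sobolev_borel[symmetric])
  finally show ?thesis .
qed

end

text \<open>The first five conjuncts make precise that \<open>\<mu>\<close> is a Borel probability
  measure on \<open>D\<close>. The almost sure properties are given under \<open>\<mu>\<close>
  itself and for every \<open>X\<close> on \<open>Q\<close> with this law.\<close>

theorem proposition4p3:
  fixes T :: real
    and M :: "'a measure"
    and W :: "real \<Rightarrow> 'a \<Rightarrow> real ^ 'n"
    and V :: "(real \<times> 'a \<Rightarrow> real) set"
    and s :: nat
    and enum :: "nat \<Rightarrow> 'n chaos_label \<times> 'd::finite"
    and \<phi> :: "nat \<Rightarrow> real \<times> 'a \<Rightarrow> real ^ 'd"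
    and dg :: "nat \<Rightarrow> nat"
    and N :: "'w measure"
    and \<xi> :: "nat \<Rightarrow> 'w \<Rightarrow> real"
    and p :: real
    and \<theta> :: "nat \<Rightarrow> real"
    and U :: "(real \<times> 'a \<Rightarrow> real ^ 'd) \<Rightarrow> (real \<times> 'a \<Rightarrow> real ^ 'd)"
    and H D :: "(real \<times> 'a \<Rightarrow> real ^ 'd) set"
    and \<mu> :: "(real \<times> 'a \<Rightarrow> real ^ 'd) measure"
    and Q :: "'q measure"
  assumes "T > 0"
    and "prob_space M" and "complete_measure M" and "brownian_motion T M W"
    and "h2_closed_subspace T M W V"
    and "h2_onb T M W V (chaoslet T W) chaos_labels"
    and H: "H = vec_space V"
    and "s \<ge> 1"
    and "bij_betw enum UNIV (chaos_labels \<times> UNIV)"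
    and \<phi>: "\<phi> = (\<lambda>k. vec_chaoslet T W (enum k))"
    and dg: "dg = (\<lambda>k. chaos_degree (fst (enum k)))"
    and "prob_space N"
    and "prob_space.indep_vars N (\<lambda>_. borel) \<xi> UNIV"
    and "\<And>k. distr N borel (\<xi> k) = distr N borel (\<xi> 0)"
    and "\<And>k. prob_space.expectation N (\<xi> k) = 0"
    and "\<And>k. prob_space.variance N (\<xi> k) = 1"
    and "\<And>k. sub_gaussian N (\<xi> k)"
    and "0 < p" and "p < 2"
    and "\<theta> \<in> lp_space p"
    and "h2_unitary T M H U"
    and "bounded_matrix_on (lp_space p) (lp_norm p) (unitary_matrix T M U \<phi>)"
    and "\<theta> \<in> weighted_l2 dg s"
    and "bounded_matrix_on (weighted_l2 dg s) (weighted_l2_norm dg s) (unitary_matrix T M U \<phi>)"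
    and D: "D = vec_space (sobolev T M W V s)"
    and \<mu>: "\<mu> = series_law N T M H \<theta> \<xi> U \<phi>"
    and "prob_space Q"
  shows
    "(AE w in N. \<exists>u\<in>H. h2_sums T M (series_term \<theta> \<xi> U \<phi> w) u) \<and>
     random_series T M H \<theta> \<xi> U \<phi> \<in> N \<rightarrow>\<^sub>M h2_borel T M H \<and>
     D \<in> sets \<mu> \<and>
     sets (restrict_space \<mu> D) = sets (norm_borel D (sobolev_norm T M W s)) \<and>
     prob_space (restrict_space \<mu> D) \<and>
     (AE u in \<mu>. compressible T M W (1 / p) u \<and> u \<in> D \<and>
        best_N_term_error T M W u \<in> O(\<lambda>n. real n powr (- (1 / p - 1 / 2)))) \<and>
     (\<forall>X. X \<in> Q \<rightarrow>\<^sub>M h2_borel T M H \<and> distr Q (h2_borel T M H) X = \<mu> \<longrightarrow>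
        (AE \<omega> in Q. compressible T M W (1 / p) (X \<omega>) \<and> X \<omega> \<in> D \<and>
           best_N_term_error T M W (X \<omega>) \<in> O(\<lambda>n. real n powr (- (1 / p - 1 / 2)))))"
proof -
  have [simp]: "0 < p" "p < 2" by fact+
  \<comment> \<open>Each label occurs as a first component because the type \<open>'d\<close> is
    inhabited; this yields countability.\<close>
  have fst_enum: "chaos_labels = (\<lambda>k. fst (enum k)) ` UNIV"
    using \<open>bij_betw enum UNIV (chaos_labels \<times> UNIV)\<close> by (force simp: bij_betw_def image_image[symmetric])
  interpret vec_chaos_onb T M W V enum
  proof (intro vec_chaos_onb.intro chaos_onb.intro h2_space.intro chaos_onb_axioms.intro
      vec_chaos_onb_axioms.intro)
    show "countable (chaos_labels :: 'n chaos_label set)"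
      by (subst fst_enum) simp
  qed fact+
  interpret N: prob_space N by fact
  define A where "A = unitary_matrix T M U \<phi>"
  define a where "a w k = \<theta> k * \<xi> k w" for w k
  define R where "R = random_series T M H \<theta> \<xi> U \<phi>"
  have A_eq: "A m n = h2_inner T M (U (\<phi> n)) (\<phi> m)" for m n
    by (simp add: A_def unitary_matrix_def)
  have \<phi>_in_H: "\<phi> k \<in> H" for k
    unfolding H \<phi> by (rule \<phi>_H)
  have \<psi>_H: "U (\<phi> k) \<in> vec_space V" for k
    using \<open>h2_unitary T M H U\<close> \<phi>_in_H by (auto simp: h2_unitary_def H)
  have \<psi>_inner: "h2_inner T M (U (\<phi> k)) (U (\<phi> l)) = (if k = l then 1 else 0)" for k l
    using \<open>h2_unitary T M H U\<close> \<phi>_in_H coord_\<phi>[of k l] by (auto simp: h2_unitary_def \<phi> coord_def)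
  have series: "series_term \<theta> \<xi> U \<phi> w = (\<lambda>k x. a w k *\<^sub>R U (\<phi> k) x)" for w
    by (simp add: series_term_def a_def fun_eq_iff)
  have [measurable]: "\<xi> k \<in> borel_measurable N" for k
    using \<open>sub_gaussian N (\<xi> k)\<close> by (simp add: sub_gaussian_def)
  have [measurable]: "(\<lambda>w. a w k) \<in> borel_measurable N" for k
    unfolding a_def by measurable
  have R_H: "R w \<in> vec_space V" for w
    unfolding R_def random_series_def series H by (rule h2_suminf_H[OF \<psi>_H \<psi>_inner])
  have R_coord: "coord (R w) m = (if summable (\<lambda>k. (a w k)\<^sup>2) then \<Sum>k. A m k * a w k else 0)" for w m
    unfolding R_def random_series_def series H A_eq
    by (subst coord_h2_suminf[OF \<psi>_H \<psi>_inner]) (simp add: \<phi>)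
  have R_meas: "R \<in> N \<rightarrow>\<^sub>M h2_borel T M H"
    unfolding H
  proof (rule measurable_h2_borelI)
    show "(\<lambda>w. coord (R w) k) \<in> borel_measurable N" for k
      unfolding R_coord by measurable
  qed (rule R_H)
  have lp: "AE w in N. a w \<in> lp_space p"
  proof -
    have "AE w in N. summable (\<lambda>k. \<bar>\<theta> k\<bar> powr p * \<bar>\<xi> k w\<bar> powr p)"
    proof (rule AE_summable_mult)
      show "summable (\<lambda>k. \<bar>\<theta> k\<bar> powr p)"
        using \<open>\<theta> \<in> lp_space p\<close> by (simp add: lp_space_def)
      show "(\<integral>\<^sup>+ w. ennreal (\<bar>\<xi> k w\<bar> powr p) \<partial>N) \<le> ennreal 2" for k
        using N.nn_integral_powr_le_two[of "\<xi> k" p] assms(15,16) less_imp_le[OF \<open>p < 2\<close>] by simp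
    qed auto
    then show ?thesis
      by (simp add: lp_space_def a_def abs_mult powr_mult)
  qed
  have wl2: "AE w in N. a w \<in> weighted_l2 dg s"
  proof -
    have "AE w in N. summable (\<lambda>k. ((1 + real (dg k)) ^ s * \<bar>\<theta> k\<bar>\<^sup>2) * (\<xi> k w)\<^sup>2)"
    proof (rule AE_summable_mult)
      show "summable (\<lambda>k. (1 + real (dg k)) ^ s * \<bar>\<theta> k\<bar>\<^sup>2)"
        using \<open>\<theta> \<in> weighted_l2 dg s\<close> by (simp add: weighted_l2_def)
      show "(\<integral>\<^sup>+ w. ennreal ((\<xi> k w)\<^sup>2) \<partial>N) \<le> ennreal 1" for k
        using N.nn_integral_square_eq_one[of "\<xi> k"] assms(15,16) by simp
    qed auto
    then show ?thesis
      by (simp add: weighted_l2_def a_def power_mult_distrib mult.assoc)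
  qed
  \<comment> \<open>The weights are at least 1, and plain square summability is what decides
    convergence of the series.\<close>
  have l2: "summable (\<lambda>k. (b k)\<^sup>2)" if "b \<in> weighted_l2 dg s" for b
  proof (rule summable_comparison_test')
    show "summable (\<lambda>k. (1 + real (dg k)) ^ s * \<bar>b k\<bar>\<^sup>2)"
      using that by (simp add: weighted_l2_def)
    show "norm ((b k)\<^sup>2) \<le> (1 + real (dg k)) ^ s * \<bar>b k\<bar>\<^sup>2" for k
      using mult_right_mono[of 1 "(1 + real (dg k)) ^ s" "(b k)\<^sup>2"] by simp
  qed
  have converges: "AE w in N. \<exists>u\<in>H. h2_sums T M (series_term \<theta> \<xi> U \<phi> w) u"
    using wl2 by eventually_elim (simp add: series H orthonormal_series_iff[OF \<psi>_H \<psi>_inner] l2)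
  have good_R: "AE w in N. R w \<in> compressible_sobolev p s"
    using lp wl2
  proof eventually_elim
    case (elim w)
    \<comment> \<open>Square summability excludes the default branch of \<open>R_coord\<close>, so
      the coordinates are the image of \<open>a w\<close> under \<open>A\<close>, and
      \<open>A\<close> preserves both sequence spaces.\<close>
    have "coord (R w) = (\<lambda>m. \<Sum>k. A m k * a w k)"
      using l2[OF elim(2)] by (simp add: R_coord fun_eq_iff)
    then show ?case
      using bounded_matrix_onD[OF assms(22) elim(1)] bounded_matrix_onD[OF assms(24) elim(2)] R_H[of w]
      by (simp add: compressible_sobolev_def A_def dg)
  qed
  have \<mu>_eq: "\<mu> = distr N (h2_borel T M H) R"
    by (simp add: \<mu> series_law_def R_def)
  have sets_\<mu>: "sets \<mu> = sets (h2_borel T M H)" and space_\<mu>: "space \<mu> = H"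
    by (simp_all add: \<mu>_eq space_h2_borel H)
  have prob_\<mu>: "prob_space \<mu>"
    unfolding \<mu>_eq by (rule N.prob_space_distr[OF R_meas])
  have D_sets: "D \<in> sets \<mu>"
    unfolding sets_\<mu> D H by (rule sets_vec_sobolev)
  have good: "AE u in \<mu>. u \<in> compressible_sobolev p s"
    unfolding \<mu>_eq
  proof (subst AE_distr_iff[OF R_meas])
    have "{u \<in> space (h2_borel T M H). u \<in> compressible_sobolev p s} = compressible_sobolev p s"
      by (auto simp: H space_h2_borel compressible_sobolev_def)
    then show "{u \<in> space (h2_borel T M H). u \<in> compressible_sobolev p s} \<in> sets (h2_borel T M H)"
      using sets_compressible_sobolev[of p s] by (simp add: H)
  qed (rule good_R)
  have conclusion: "compressible T M W (1 / p) u \<and> u \<in> D \<and>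
      best_N_term_error T M W u \<in> O(\<lambda>n. real n powr (- (1 / p - 1 / 2)))"
    if "u \<in> compressible_sobolev p s" for u
    using compressible_sobolevD[OF _ that] by (simp add: D)
  have "AE u in \<mu>. u \<in> D"
    using good by eventually_elim (simp add: conclusion)
  then have "emeasure \<mu> D = 1"
    by (rule prob_space.emeasure_eq_1_AE[OF prob_\<mu> D_sets])
  then have "prob_space (restrict_space \<mu> D)"
    by (rule prob_space_restrict_space[OF D_sets])
  moreover have "sets (restrict_space \<mu> D) = sets (norm_borel D (sobolev_norm T M W s))"
    unfolding sets_restrict_space_cong[OF sets_\<mu>] unfolding D H by (rule sets_restrict_vec_sobolev)
  moreover have "AE \<omega> in Q. compressible T M W (1 / p) (X \<omega>) \<and> X \<omega> \<in> D \<and>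
      best_N_term_error T M W (X \<omega>) \<in> O(\<lambda>n. real n powr (- (1 / p - 1 / 2)))"
    if "X \<in> Q \<rightarrow>\<^sub>M h2_borel T M H" "distr Q (h2_borel T M H) X = \<mu>" for X
    using AE_distrD[OF that(1) good[folded that(2)]] by eventually_elim (rule conclusion)
  moreover have "AE u in \<mu>. compressible T M W (1 / p) u \<and> u \<in> D \<and>
      best_N_term_error T M W u \<in> O(\<lambda>n. real n powr (- (1 / p - 1 / 2)))"
    using good by eventually_elim (rule conclusion)
  ultimately show ?thesis
    using converges R_meas[unfolded R_def] D_sets by blast
qed

end
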